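(* Let $n\ge 2$, let $\Omega\subset\mathbb C^n$ be a domain and let $E\subset\mathbb C^n$ be a closed set such that: (1) there exists $r>0$ with $E_r:=\{z\in\mathbb C^n: d(z,E)\le r\}\subset\Omega$; (2) there exist an affine-linear subspace $H\subset\mathbb R^{2n}=\mathbb C^n$ of real codimension $\ge 3$ and a number $R>0$ such that $E\subset H_R:=\{z\in\mathbb C^n: d(z,H)<R\}$; (3) $\Omega\setminus E$ is connected. Then every square-integrable holomorphic function on $\Omega\setminus E$ extends to a square-integrable holomorphic function on $\Omega$. In other words, the Bergman space $A^2(\Omega\setminus E)$ coincides with $A^2(\Omega)$ (via restriction).
   Context: $d(\cdot,\cdot)$ denotes Euclidean distance. For an open set $D\subset\mathbb C^n$, $A^2(D)$ is the space of holomorphic functions $f$ on $D$ with $\int_D|f|^2<\infty$ (Lebesgue measure). *)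

theory Defs
  imports "HOL-Analysis.Analysis"
begin

definition holo_on :: "(complex ^ 'n \<Rightarrow> complex) \<Rightarrow> (complex ^ 'n) set \<Rightarrow> bool" where
  "holo_on f U \<longleftrightarrow> (\<forall>z\<in>U. \<exists>L. (f has_derivative L) (at z) \<and>
       (\<forall>c v. L (c *s v) = c * L v))"

definition bergman :: "(complex ^ 'n) set \<Rightarrow> (complex ^ 'n \<Rightarrow> complex) \<Rightarrow> bool" where
  "bergman D f \<longleftrightarrow> holo_on f D \<and> (\<lambda>z. (cmod (f z))\<^sup>2) integrable_on D"

text \<open>Closed r-neighbourhood {z. d(z,E) \<le> r}; empty when E is empty (d(z,{}) = \<infinity>).\<close>
definition closed_nbhd :: "'a::metric_space set \<Rightarrow> real \<Rightarrow> 'a set" where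
  "closed_nbhd E r = {z. E \<noteq> {} \<and> infdist z E \<le> r}"

definition open_nbhd :: "'a::metric_space set \<Rightarrow> real \<Rightarrow> 'a set" where
  "open_nbhd H R = {z. H \<noteq> {} \<and> infdist z H < R}"

end

theory Submission
  imports Defs "HOL-Complex_Analysis.Complex_Analysis" "HOL-Real_Asymp.Real_Asymp"
begin

text \<open>
  Because the direction space of \<open>H\<close> has real codimension at least 3, some complex line through the
  origin meets it only in 0; let \<open>w\<close> span this line. Then every slice \<open>{c. z + c w \<in> E}\<close> is compact,
  with locally uniform bounds. On a slice, choose a cutoff \<open>\<phi>\<close> equal to 1 near 0 and near the slice
  of \<open>E\<close>, with compact support in the slice of \<open>\<Omega>\<close>, and put
  \<open>g z = - 1 / \<pi> \<integral> (d-bar \<phi>)(c) f (z + c w) / c\<close>. The value does not depend on \<open>\<phi>\<close>, so the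
  same \<open>\<phi>\<close> may be used for all nearby \<open>z\<close> and \<open>g\<close> is holomorphic on \<open>\<Omega>\<close>; it agrees with \<open>f\<close> on
  the lines that miss \<open>E\<close>. There is still a nonzero \<open>v\<close> orthogonal to \<open>H\<close> and to the complex line,
  and just beyond the supremum of \<open>v \<bullet> z\<close> over \<open>E\<close> there are points of \<open>\<Omega>\<close> on such lines, so the
  identity theorem on \<open>\<Omega> - E\<close> gives \<open>g = f\<close>. Square integrability over \<open>E\<close> follows by
  applying the maximum principle on slices of a tube around \<open>E\<close>, an area mean value bound on its
  boundary, and Tonelli with translation invariance.
\<close>

section \<open>Continuity, integrals and derivatives of compactly supported functions\<close>

lemma continuous_on_mult_compact_support:
  fixes b h :: "'a::t2_space \<Rightarrow> complex"
  assumes "continuous_on UNIV b" "compact K" "\<And>x. x \<notin> K \<Longrightarrow> b x = 0" "K \<subseteq> V" "open V" "continuous_on V h"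
  shows "continuous_on UNIV (\<lambda>x. b x * h x)"
proof -
  have "continuous_on V (\<lambda>x. b x * h x)"
    by (intro continuous_intros assms continuous_on_subset[OF assms(1)]) auto
  moreover have "continuous_on (- K) (\<lambda>x. b x * h x)"
    using assms(3) by (subst continuous_on_cong[OF refl, where g="\<lambda>_. 0"]) auto
  ultimately have "continuous_on (V \<union> - K) (\<lambda>x. b x * h x)"
    using assms by (intro continuous_on_open_Un) (auto simp: compact_imp_closed open_Compl)
  moreover have "V \<union> - K = UNIV" using assms by auto
  ultimately show ?thesis by simp
qed

lemma integrable_compact_support:
  fixes F :: "'a::euclidean_space \<Rightarrow> 'b::{banach, second_countable_topology}"
  assumes "continuous_on K F" "compact K" "\<And>x. x \<notin> K \<Longrightarrow> F x = 0"
  shows "integrable lborel F"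
proof -
  have "integrable lborel (\<lambda>x. indicator K x *\<^sub>R F x)"
    using assms by (intro borel_integrable_compact)
  moreover have "(\<lambda>x. indicator K x *\<^sub>R F x) = F"
    using assms(3) by (auto simp: indicator_def fun_eq_iff)
  ultimately show ?thesis by simp
qed

lemma lebesgue_integral_translate:
  fixes F :: "'a::euclidean_space \<Rightarrow> 'b::{banach, second_countable_topology}"
  assumes "F \<in> borel_measurable borel"
  shows "(\<integral>x. F (a + x) \<partial>lborel) = (\<integral>x. F x \<partial>lborel)"
proof -
  have "(\<integral>x. F x \<partial>lborel) = (\<integral>x. F x \<partial>distr lborel borel ((+) a))"
    by (simp add: lborel_distr_plus)
  also have "\<dots> = (\<integral>x. F (a + x) \<partial>lborel)"
    using assms by (intro integral_distr) auto
  finally show ?thesis by simp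
qed

text \<open>By translation invariance each difference quotient of \<open>F\<close> in direction
  \<open>v\<close> has integral 0, and dominated convergence carries this over to the
  derivative.\<close>

lemma integral_derivative_compact_support:
  fixes F :: "'a::euclidean_space \<Rightarrow> 'b::euclidean_space"
  assumes F: "\<And>x. (F has_derivative D x) (at x)"
    and D: "continuous_on UNIV (\<lambda>x. D x v)"
    and K: "compact K" "\<And>x. x \<notin> K \<Longrightarrow> F x = 0"
  shows "(\<integral>x. D x v \<partial>lborel) = 0"
proof -
  have contF: "continuous_on S F" for S
    using F by (meson has_derivative_continuous continuous_at_imp_continuous_on)
  have D0: "D x v = 0" if "x \<notin> K" for x
  proof -
    have "((\<lambda>_. 0) has_derivative D x) (at x)"
    proof (rule has_derivative_transform_within_open[OF F])
      show "open (- K)" using K by (simp add: compact_imp_closed open_Compl)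
    qed (use that K in auto)
    then have "D x = (\<lambda>_. 0)" by (rule has_derivative_unique) simp
    then show ?thesis by simp
  qed
  have "bounded ((\<lambda>x. D x v) ` K)"
    using K continuous_on_subset[OF D] by (intro compact_imp_bounded compact_continuous_image) auto
  then obtain B where B: "B > 0" "\<And>x. x \<in> K \<Longrightarrow> norm (D x v) \<le> B"
    by (metis bounded_pos imageI)
  have B': "norm (D x v) \<le> B" for x
    using B D0[of x] by (cases "x \<in> K") auto
  \<comment> \<open>The mean value inequality along the segment in direction \<open>v\<close> bounds
    all difference quotients by \<open>B\<close>; this is the dominating constant.\<close>
  have lip: "norm (F (x + t *\<^sub>R v) - F x) \<le> B * t" if "t \<ge> 0" for x t
  proof -
    have "norm (F (x + t *\<^sub>R v) - F (x + 0 *\<^sub>R v)) \<le> B * norm (t - 0)"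
    proof (rule differentiable_bound[where S="UNIV" and f'="\<lambda>s u. D (x + s *\<^sub>R v) (u *\<^sub>R v)"])
      fix s :: real
      show "((\<lambda>t. F (x + t *\<^sub>R v)) has_derivative (\<lambda>u. D (x + s *\<^sub>R v) (u *\<^sub>R v))) (at s within UNIV)"
        by (rule has_derivative_compose[OF _ F]) (auto intro!: derivative_eq_intros)
      have lin: "linear (D (x + s *\<^sub>R v))" using F has_derivative_linear by blast
      show "onorm (\<lambda>u. D (x + s *\<^sub>R v) (u *\<^sub>R v)) \<le> B"
        using B' by (intro onorm_le) (auto simp: linear_cmul[OF lin] mult.commute[of B] intro: mult_left_mono)
    qed auto
    then show ?thesis using that by simp
  qed
  obtain r where r: "\<And>x. x \<in> K \<Longrightarrow> norm x \<le> r"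
    using compact_imp_bounded[OF K(1)] by (meson bounded_iff)
  define q where "q n x = real (Suc n) *\<^sub>R (F (x + (1 / real (Suc n)) *\<^sub>R v) - F x)" for n x
  have q0: "(\<integral>x. q n x \<partial>lborel) = 0" for n
  proof -
    have m: "F \<in> borel_measurable borel" using contF by (simp add: borel_measurable_continuous_onI)
    have i: "integrable lborel F" using contF K by (intro integrable_compact_support)
    have "integrable lborel (\<lambda>x. F ((1 / real (Suc n)) *\<^sub>R v + x))"
    proof (rule integrable_compact_support[where K="(\<lambda>x. x - (1 / real (Suc n)) *\<^sub>R v) ` K"])
      show "continuous_on ((\<lambda>x. x - (1 / real (Suc n)) *\<^sub>R v) ` K) (\<lambda>x. F ((1 / real (Suc n)) *\<^sub>R v + x))"
        by (intro continuous_on_compose2[OF contF[of UNIV]] continuous_intros) auto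
      show "compact ((\<lambda>x. x - (1 / real (Suc n)) *\<^sub>R v) ` K)"
        using K by (intro compact_continuous_image continuous_intros)
      fix x assume "x \<notin> (\<lambda>x. x - (1 / real (Suc n)) *\<^sub>R v) ` K"
      then have "(1 / real (Suc n)) *\<^sub>R v + x \<notin> K"
        by (metis add_diff_cancel_left' imageI)
      then show "F ((1 / real (Suc n)) *\<^sub>R v + x) = 0" using K by auto
    qed
    then show ?thesis
      unfolding q_def using i lebesgue_integral_translate[OF m, of "(1 / real (Suc n)) *\<^sub>R v"]
      by (simp add: add.commute)
  qed
  \<comment> \<open>The steps \<open>1 / Suc n\<close> are at most 1, so outside the ball of radius
    \<open>r + norm v\<close> neither \<open>x\<close> nor the shifted point lies in
    \<open>K\<close>, and \<open>q n x = 0\<close>.\<close>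
  have "(\<lambda>n. \<integral>x. q n x \<partial>lborel) \<longlonglongrightarrow> (\<integral>x. D x v \<partial>lborel)"
  proof (rule integral_dominated_convergence[where w="\<lambda>x. indicator (cball 0 (r + norm v)) x *\<^sub>R B"])
    show "(\<lambda>x. D x v) \<in> borel_measurable lborel"
      using D by (simp add: borel_measurable_continuous_onI)
    show "q n \<in> borel_measurable lborel" for n
      unfolding q_def
      by (auto intro!: borel_measurable_continuous_onI continuous_intros continuous_on_compose2[OF contF[of UNIV]])
    show "integrable lborel (\<lambda>x. indicator (cball 0 (r + norm v)) x *\<^sub>R B)"
      by (intro borel_integrable_compact) auto
    show "AE x in lborel. (\<lambda>n. q n x) \<longlonglongrightarrow> D x v"
    proof (rule AE_I2)
      fix x
      have "((\<lambda>t. F (x + t *\<^sub>R v)) has_derivative (\<lambda>u. D x (u *\<^sub>R v))) (at 0)"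
        by (rule has_derivative_compose[where g=F and g'="D x"])
          (use F[of x] in \<open>auto intro!: derivative_eq_intros\<close>)
      then have "((\<lambda>t. norm (F (x + t *\<^sub>R v) - F x - D x (t *\<^sub>R v)) / norm t) \<longlongrightarrow> 0) (at 0)"
        by (simp add: has_derivative_at)
      moreover have "filterlim (\<lambda>n. 1 / real (Suc n)) (at 0) sequentially"
        by real_asymp
      ultimately have "(\<lambda>n. norm (F (x + (1 / real (Suc n)) *\<^sub>R v) - F x - D x ((1 / real (Suc n)) *\<^sub>R v)) / norm (1 / real (Suc n))) \<longlonglongrightarrow> 0"
        by (rule filterlim_compose)
      moreover have lin: "linear (D x)" using F has_derivative_linear by blast
      have "norm (F (x + (1 / real (Suc n)) *\<^sub>R v) - F x - D x ((1 / real (Suc n)) *\<^sub>R v)) / norm (1 / real (Suc n)) = norm (q n x - D x v)" for n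
      proof -
        have "q n x - D x v = real (Suc n) *\<^sub>R (F (x + (1 / real (Suc n)) *\<^sub>R v) - F x - D x ((1 / real (Suc n)) *\<^sub>R v))"
          by (simp add: q_def linear_cmul[OF lin] scaleR_diff_right del: of_nat_Suc)
        then have "norm (q n x - D x v) = real (Suc n) * norm (F (x + (1 / real (Suc n)) *\<^sub>R v) - F x - D x ((1 / real (Suc n)) *\<^sub>R v))"
          by (simp only: norm_scaleR abs_of_nat)
        then show ?thesis by (simp add: divide_inverse mult.commute)
      qed
      ultimately have "(\<lambda>n. norm (q n x - D x v)) \<longlonglongrightarrow> 0" by simp
      then show "(\<lambda>n. q n x) \<longlonglongrightarrow> D x v"
        using Lim_null tendsto_norm_zero_iff by blast
    qed
    show "AE x in lborel. norm (q n x) \<le> indicator (cball 0 (r + norm v)) x *\<^sub>R B" for n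
    proof (rule AE_I2)
      fix x
      show "norm (q n x) \<le> indicator (cball 0 (r + norm v)) x *\<^sub>R B"
      proof (cases "x \<in> cball 0 (r + norm v)")
        case True
        have "norm (q n x) = real (Suc n) * norm (F (x + (1 / real (Suc n)) *\<^sub>R v) - F x)"
          unfolding q_def by (simp only: norm_scaleR abs_of_nat)
        also have "\<dots> \<le> real (Suc n) * (B * (1 / real (Suc n)))"
          using lip[of "1 / real (Suc n)" x] by (intro mult_left_mono) auto
        also have "\<dots> = B" by simp
        finally show ?thesis using True by simp
      next
        case False
        have "x \<notin> K" using False r[of x] norm_ge_zero[of v] by (auto simp: dist_norm)
        moreover have "x + (1 / real (Suc n)) *\<^sub>R v \<notin> K"
        proof
          assume "x + (1 / real (Suc n)) *\<^sub>R v \<in> K"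
          then have "norm (x + (1 / real (Suc n)) *\<^sub>R v) \<le> r" using r by blast
          moreover have "norm x \<le> norm (x + (1 / real (Suc n)) *\<^sub>R v) + norm ((1 / real (Suc n)) *\<^sub>R v)"
            by (metis add_diff_cancel_right' norm_triangle_ineq4)
          moreover have "norm ((1 / real (Suc n)) *\<^sub>R v) \<le> norm v"
            by (simp add: field_simps)
          ultimately show False using False by (simp add: dist_norm)
        qed
        ultimately show ?thesis using K False by (simp add: q_def)
      qed
    qed
  qed
  then show ?thesis using q0 LIMSEQ_unique[of "\<lambda>_. 0::'b"] by simp
qed

subsection \<open>Cutoff functions on the complex plane\<close>

text \<open>For real \<open>\<phi>\<close> with gradient \<open>A\<close>, regarded as a complex number, \<open>A\<close> is twice the
  d-bar derivative of \<open>\<phi>\<close>.\<close>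

definition cutoff :: "(complex \<Rightarrow> real) \<Rightarrow> (complex \<Rightarrow> complex) \<Rightarrow> complex set \<Rightarrow> bool" where
  "cutoff \<phi> A K \<longleftrightarrow> compact K \<and> continuous_on UNIV A \<and>
     (\<forall>x. (\<phi> has_derivative (\<lambda>v. A x \<bullet> v)) (at x)) \<and> (\<forall>x. x \<notin> K \<longrightarrow> \<phi> x = 0)"

lemma cutoff_gradient_zero:
  assumes "cutoff \<phi> A K" "open U" "x \<in> U" "\<And>y. y \<in> U \<Longrightarrow> \<phi> y = c"
  shows "A x = 0"
proof -
  have "((\<lambda>_. c) has_derivative (\<lambda>v. A x \<bullet> v)) (at x)"
    using assms unfolding cutoff_def
    by (intro has_derivative_transform_within_open[of \<phi> _ x UNIV U "\<lambda>_. c"]) auto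
  then have "(\<lambda>v. A x \<bullet> v) = (\<lambda>_. 0)" by (rule has_derivative_unique) simp
  then show ?thesis by (metis inner_eq_zero_iff)
qed

lemma cutoff_gradient_support:
  assumes "cutoff \<phi> A K" "x \<notin> K"
  shows "A x = 0"
  using assms by (intro cutoff_gradient_zero[of \<phi> A K "-K" x 0])
    (auto simp: cutoff_def compact_imp_closed open_Compl)

text \<open>Subtracting cutoffs that agree on \<open>U\<close> moves the support out of
  \<open>U\<close>. An integrand with singularities inside \<open>U\<close> then falls under the
  purely holomorphic case.\<close>

lemma cutoff_diff:
  assumes "cutoff \<phi> A K" "cutoff \<phi>' A' K'" "open U" "\<And>x. x \<in> U \<Longrightarrow> \<phi> x = \<phi>' x"
  shows "cutoff (\<lambda>x. \<phi> x - \<phi>' x) (\<lambda>x. A x - A' x) ((K \<union> K') - U)"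
proof -
  have "((\<lambda>x. \<phi> x - \<phi>' x) has_derivative (\<lambda>v. (A x - A' x) \<bullet> v)) (at x)" for x
    unfolding inner_diff_left using assms by (intro has_derivative_diff) (auto simp: cutoff_def)
  then show ?thesis
    using assms unfolding cutoff_def by (auto intro!: continuous_intros compact_diff)
qed

text \<open>Stokes' theorem in disguise: since \<open>h\<close> is holomorphic, \<open>A * h\<close>
  is twice d-bar of the compactly supported function \<open>\<phi> * h\<close>, and both partial
  derivatives of that function have integral 0.\<close>

lemma cutoff_integral_holomorphic:
  assumes \<phi>: "cutoff \<phi> A K" and V: "open V" "K \<subseteq> V" and h: "h holomorphic_on V"
  shows "(\<integral>x. A x * h x \<partial>lborel) = 0"
proof -
  define D where "D x v = of_real (A x \<bullet> v) * h x + of_real (\<phi> x) * deriv h x * v" for x v :: complex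
  have K: "compact K" and A: "continuous_on UNIV A" using \<phi> by (auto simp: cutoff_def)
  have A0: "A x = 0" if "x \<notin> K" for x using cutoff_gradient_support[OF \<phi> that] .
  have \<phi>0: "\<phi> x = 0" if "x \<notin> K" for x using \<phi> that by (simp add: cutoff_def)
  have d\<phi>: "(\<phi> has_derivative (\<lambda>v. A x \<bullet> v)) (at x)" for x using \<phi> by (simp add: cutoff_def)
  have cont\<phi>: "continuous_on UNIV \<phi>"
    using d\<phi> by (meson has_derivative_continuous continuous_at_imp_continuous_on)
  have conth: "continuous_on V h" "continuous_on V (deriv h)"
    using h V by (auto intro: holomorphic_on_imp_continuous_on holomorphic_deriv)
  have der: "((\<lambda>x. of_real (\<phi> x) * h x) has_derivative D x) (at x)" for x
  proof (cases "x \<in> V")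
    case True
    then have "(h has_field_derivative deriv h x) (at x)"
      using h V holomorphic_derivI by blast
    then have *: "(h has_derivative (*) (deriv h x)) (at x)"
      by (simp add: has_field_derivative_def)
    show ?thesis
      unfolding D_def
      by (auto intro!: derivative_eq_intros d\<phi> * simp: algebra_simps)
  next
    case False
    then have x: "x \<in> - K" using V by auto
    have "((\<lambda>x. of_real (\<phi> x) * h x) has_derivative (\<lambda>_. 0)) (at x)"
      by (rule has_derivative_transform_within_open[of "\<lambda>_. 0" _ _ _ "-K"])
        (use x K \<phi>0 in \<open>auto simp: compact_imp_closed open_Compl\<close>)
    moreover have "D x = (\<lambda>_. 0)" using x A0 \<phi>0 by (auto simp: D_def)
    ultimately show ?thesis by simp
  qed
  have contD: "continuous_on UNIV (\<lambda>x. D x v)" for v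
  proof -
    have "continuous_on UNIV (\<lambda>x. of_real (A x \<bullet> v) * h x)"
      by (rule continuous_on_mult_compact_support[OF _ K _ V(2,1) conth(1)])
        (use A A0 in \<open>auto intro!: continuous_intros\<close>)
    moreover have "continuous_on UNIV (\<lambda>x. of_real (\<phi> x) * deriv h x)"
      by (rule continuous_on_mult_compact_support[OF _ K _ V(2,1) conth(2)])
        (use cont\<phi> \<phi>0 in \<open>auto intro!: continuous_intros\<close>)
    ultimately show ?thesis unfolding D_def by (intro continuous_on_add continuous_on_mult_right)
  qed
  have D0: "(\<integral>x. D x v \<partial>lborel) = 0" for v
    using integral_derivative_compact_support[OF der contD K] \<phi>0 by simp
  have int: "integrable lborel (\<lambda>x. D x v)" for v
    using A0 \<phi>0 by (intro integrable_compact_support[OF continuous_on_subset[OF contD] K]) (auto simp: D_def)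
  \<comment> \<open>The terms with \<open>deriv h x\<close> cancel because
    \<open>1 + \<i> * \<i> = 0\<close>; this is the Cauchy-Riemann equation for
    \<open>h\<close>.\<close>
  have "A x * h x = D x 1 + \<i> * D x \<i>" for x
  proof -
    have "A x = of_real (A x \<bullet> 1) + \<i> * of_real (A x \<bullet> \<i>)"
      by (simp add: complex_eq_iff inner_complex_def)
    then have "A x * h x = (of_real (A x \<bullet> 1) + \<i> * of_real (A x \<bullet> \<i>)) * h x" by simp
    then show ?thesis by (simp add: D_def algebra_simps)
  qed
  then have "(\<integral>x. A x * h x \<partial>lborel) = (\<integral>x. D x 1 + \<i> * D x \<i> \<partial>lborel)" by simp
  also have "\<dots> = 0" using int D0 by simp
  finally show ?thesis .
qed


text \<open>The squared positive part is continuously differentiable, which is all the smoothness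
  that \<open>cutoff\<close> asks for. At 0 the difference quotient is bounded by
  \<open>\<bar>h\<bar>\<close>.\<close>

lemma DERIV_max_0_square: "((\<lambda>t::real. (max 0 t)\<^sup>2) has_real_derivative 2 * max 0 t) (at t)"
proof -
  consider "t < 0" | "t = 0" | "t > 0" by linarith
  then show ?thesis
  proof cases
    case 1
    have "((\<lambda>t::real. (max 0 t)\<^sup>2) has_real_derivative 0) (at t)"
      by (rule has_field_derivative_transform_within_open[of "\<lambda>_. 0" _ _ "{..<0}"]) (use 1 in auto)
    then show ?thesis using 1 by simp
  next
    case 2
    have "((\<lambda>h. max 0 (0 + h) * (max 0 h / h)) \<longlongrightarrow> (0::real)) (at 0)"
    proof (rule Lim_null_comparison)
      show "eventually (\<lambda>h. norm (max 0 (0 + h) * (max 0 h / h)) \<le> \<bar>h\<bar>) (at (0::real))"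
        by (auto simp: max_def intro!: always_eventually)
      show "((\<lambda>h. \<bar>h\<bar>) \<longlongrightarrow> 0) (at (0::real))" by (simp add: tendsto_rabs_zero)
    qed
    then show ?thesis using 2 by (simp add: DERIV_def power2_eq_square)
  next
    case 3
    have "((\<lambda>t::real. (max 0 t)\<^sup>2) has_real_derivative 2 * t) (at t)"
      by (rule has_field_derivative_transform_within_open[of "\<lambda>t. t\<^sup>2" _ _ "{0<..}"])
        (use 3 in \<open>auto intro!: derivative_eq_intros\<close>)
    then show ?thesis using 3 by simp
  qed
qed

lemma has_derivative_max_0_square:
  fixes u :: "complex \<Rightarrow> real"
  assumes "(u has_derivative (\<lambda>v. a \<bullet> v)) (at x)"
  shows "((\<lambda>x. (max 0 (u x))\<^sup>2) has_derivative (\<lambda>v. ((2 * max 0 (u x)) *\<^sub>R a) \<bullet> v)) (at x)"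
proof -
  have "((\<lambda>t::real. (max 0 t)\<^sup>2) has_derivative (\<lambda>h. (2 * max 0 (u x)) * h)) (at (u x))"
    using DERIV_max_0_square by (simp add: has_field_derivative_def)
  from has_derivative_compose[OF assms this] show ?thesis by simp
qed

lemma has_derivative_one_minus_max_0_square:
  fixes u :: "complex \<Rightarrow> real"
  assumes "(u has_derivative (\<lambda>v. - (a \<bullet> v))) (at x)"
  shows "((\<lambda>x. 1 - (max 0 (u x))\<^sup>2) has_derivative (\<lambda>v. ((2 * max 0 (u x)) *\<^sub>R a) \<bullet> v)) (at x)"
  using has_derivative_diff[OF has_derivative_const[of 1] has_derivative_max_0_square[of u "- a" x]] assms
  by simp

text \<open>Cover \<open>K0\<close> by finitely many balls whose closures lie in \<open>V\<close>.
  The sum \<open>s\<close> of the squared bumps is positive on \<open>K0\<close> and zero off these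
  balls; composing it with a function that rises from 0 to a plateau at 1 gives the cutoff.\<close>

lemma cutoff_exists:
  assumes K0: "compact K0" and V: "open V" "K0 \<subseteq> V"
  obtains \<phi> A K U where "cutoff \<phi> A K" "K \<subseteq> V" "open U" "K0 \<subseteq> U" "\<And>x. x \<in> U \<Longrightarrow> \<phi> x = 1"
proof -
  have "\<forall>p\<in>K0. \<exists>e>0. cball p e \<subseteq> V" using V open_contains_cball by blast
  then obtain e where e: "\<And>p. p \<in> K0 \<Longrightarrow> e p > 0 \<and> cball p (e p) \<subseteq> V" by metis
  have "K0 \<subseteq> (\<Union>p\<in>K0. ball p (e p))" using e by auto
  then obtain P where P: "P \<subseteq> K0" "finite P" "K0 \<subseteq> (\<Union>p\<in>P. ball p (e p))"
    using K0 compactE_image[of K0 K0 "\<lambda>p. ball p (e p)"] by (metis open_ball)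
  define u where "u p x = (e p)\<^sup>2 - (x - p) \<bullet> (x - p)" for p x :: complex
  define s where "s x = (\<Sum>p\<in>P. (max 0 (u p x))\<^sup>2)" for x
  define S where "S x = (\<Sum>p\<in>P. (2 * max 0 (u p x)) *\<^sub>R (- 2 *\<^sub>R (x - p)))" for x
  have u: "u p x = (e p)\<^sup>2 - (dist p x)\<^sup>2" for p x
    by (simp add: u_def dist_norm norm_minus_commute dot_square_norm)
  have du: "(u p has_derivative (\<lambda>v. (- 2 *\<^sub>R (x - p)) \<bullet> v)) (at x)" for p x
    unfolding u_def by (auto intro!: derivative_eq_intros simp: inner_commute algebra_simps)
  have contu: "continuous_on UNIV (u p)" for p
    unfolding u_def by (intro continuous_intros)
  have ds: "(s has_derivative (\<lambda>v. S x \<bullet> v)) (at x)" for x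
    unfolding s_def S_def inner_sum_left
    by (intro has_derivative_sum has_derivative_max_0_square du)
  have contS: "continuous_on UNIV S"
    unfolding S_def by (intro continuous_intros contu)
  have conts: "continuous_on UNIV s"
    unfolding s_def by (intro continuous_intros contu)
  have spos: "s x > 0" if x: "x \<in> K0" for x
  proof -
    obtain p where p: "p \<in> P" "x \<in> ball p (e p)" using x P by blast
    then have "u p x > 0" unfolding u using power_strict_mono[of "dist p x" "e p" 2] by simp
    then show ?thesis unfolding s_def using p P by (intro sum_pos2[of P p]) auto
  qed
  obtain c where c: "c > 0" "\<And>x. x \<in> K0 \<Longrightarrow> s x \<ge> c"
  proof (cases "K0 = {}")
    case False
    then obtain y where "y \<in> K0" "\<And>x. x \<in> K0 \<Longrightarrow> s y \<le> s x"
      using continuous_attains_inf[OF K0] continuous_on_subset[OF conts] by (metis subset_UNIV)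
    then show ?thesis using that spos by blast
  qed (use that[of 1] in auto)
  \<comment> \<open>With this scale \<open>k * s x \<ge> 1\<close> as soon as
    \<open>s x \<ge> c / 2\<close>, so the plateau contains the open set
    \<open>{x. c / 2 < s x}\<close>, a neighbourhood of \<open>K0\<close>.\<close>
  define k where "k = 2 / c"
  define K where "K = (\<Union>p\<in>P. cball p (e p))"
  have s0: "s x = 0" if "x \<notin> K" for x
  proof -
    have "u p x \<le> 0" if "p \<in> P" for p
    proof -
      have "e p < dist p x" "0 < e p" using that \<open>x \<notin> K\<close> P e by (auto simp: K_def)
      then show ?thesis unfolding u using power_mono[of "e p" "dist p x" 2] by simp
    qed
    then have "max 0 (u p x) = 0" if "p \<in> P" for p using that by (simp add: max_absorb1)
    then show ?thesis by (simp add: s_def)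
  qed
  have "cutoff (\<lambda>x. 1 - (max 0 (1 - k * s x))\<^sup>2) (\<lambda>x. (2 * max 0 (1 - k * s x)) *\<^sub>R (k *\<^sub>R S x)) K"
    unfolding cutoff_def
  proof (intro conjI allI impI)
    show "compact K" using P by (auto simp: K_def)
    show "continuous_on UNIV (\<lambda>x. (2 * max 0 (1 - k * s x)) *\<^sub>R (k *\<^sub>R S x))"
      by (intro continuous_intros conts contS)
    show "1 - (max 0 (1 - k * s x))\<^sup>2 = 0" if "x \<notin> K" for x using s0[OF that] by simp
    fix x
    have "((\<lambda>x. 1 - k * s x) has_derivative (\<lambda>v. - ((k *\<^sub>R S x) \<bullet> v))) (at x)"
      by (auto intro!: derivative_eq_intros ds)
    then
    show "((\<lambda>x. 1 - (max 0 (1 - k * s x))\<^sup>2) has_derivative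
        (\<lambda>v. ((2 * max 0 (1 - k * s x)) *\<^sub>R (k *\<^sub>R S x)) \<bullet> v)) (at x)"
      by (rule has_derivative_one_minus_max_0_square)
  qed
  moreover have "K \<subseteq> V" using e P by (auto simp: K_def)
  moreover have "open {x. c / 2 < s x}"
    by (intro open_Collect_less continuous_intros conts)
  moreover have "K0 \<subseteq> {x. c / 2 < s x}" using c by (smt (verit) field_sum_of_halves mem_Collect_eq subsetI)
  moreover have "1 - (max 0 (1 - k * s x))\<^sup>2 = 1" if "x \<in> {x. c / 2 < s x}" for x
    using that c by (auto simp: k_def max_def field_simps)
  ultimately show thesis using that by blast
qed

text \<open>The value is \<open>2 * pi\<close>, but only its being nonzero matters. The integrand is \<open>- A x / x\<close> for the
  gradient \<open>A\<close> of an explicit radial cutoff.\<close>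

definition cutoff_mass :: real where
  "cutoff_mass = (\<integral>x. 8 * max 0 (1 - (max 0 (2 - (cmod x)\<^sup>2))\<^sup>2) * max 0 (2 - (cmod x)\<^sup>2) \<partial>lborel)"

text \<open>A nonnegative continuous integrand with integral 0 would be positive only on a null set,
  but the set where it is positive is open and nonempty.\<close>

lemma cutoff_mass_nonzero: "cutoff_mass \<noteq> 0"
proof
  define m where "m x = 8 * max 0 (1 - (max 0 (2 - (cmod x)\<^sup>2))\<^sup>2) * max 0 (2 - (cmod x)\<^sup>2)" for x
  assume "cutoff_mass = 0"
  then have 0: "(\<integral>x. m x \<partial>lborel) = 0" by (simp add: cutoff_mass_def m_def)
  have cont: "continuous_on UNIV m" unfolding m_def by (intro continuous_intros)
  have "integrable lborel m"
  proof (rule integrable_compact_support[OF continuous_on_subset[OF cont]])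
    show "compact (cball 0 2 :: complex set)" by simp
    fix x :: complex assume "x \<notin> cball 0 2"
    then have "2 ^ 2 \<le> (cmod x)\<^sup>2" by (intro power_mono) auto
    then show "m x = 0" by (simp add: m_def)
  qed simp
  moreover have "m x \<ge> 0" for x by (simp add: m_def)
  ultimately have "AE x in lborel. m x = 0"
    using 0 integral_nonneg_eq_0_iff_AE[of lborel m] by simp
  then obtain N where N: "N \<in> null_sets lborel" "{x. m x \<noteq> 0} \<subseteq> N"
    by (auto simp: eventually_ae_filter)
  then have "negligible {x. m x \<noteq> 0}"
    using negligible_iff_null_sets null_sets_completionI negligible_subset by blast
  moreover have "open {x. m x \<noteq> 0}" using cont by (intro open_Collect_neq continuous_intros)
  \<comment> \<open>Any point of the annulus \<open>1 < (cmod x)\<^sup>2 < 2\<close> serves: there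
    both factors of the integrand are positive.\<close>
  moreover have "complex_of_real (sqrt (3/2)) \<in> {x. m x \<noteq> 0}"
    by (simp add: m_def power2_eq_square)
  ultimately show False using open_not_negligible by blast
qed

text \<open>Both gradients vanish on \<open>U\<close>, so \<open>h\<close> may be singular there.
  The difference of the cutoffs is supported in \<open>K \<union> K' - U\<close>, where
  \<open>h\<close> is holomorphic, so its integral against \<open>h\<close> vanishes.\<close>

lemma cutoff_integral_independent:
  assumes \<phi>: "cutoff \<phi> A K" and \<phi>': "cutoff \<phi>' A' K'"
    and U: "open U" "\<And>x. x \<in> U \<Longrightarrow> \<phi> x = 1" "\<And>x. x \<in> U \<Longrightarrow> \<phi>' x = 1"
    and V: "open V" "K \<union> K' - U \<subseteq> V" "h holomorphic_on V"
  shows "(\<integral>x. A x * h x \<partial>lborel) = (\<integral>x. A' x * h x \<partial>lborel)"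
proof -
  have int: "integrable lborel (\<lambda>x. B x * h x)"
    if "cutoff \<psi> B L" "\<And>x. x \<in> U \<Longrightarrow> \<psi> x = 1" "L \<subseteq> K \<union> K'" for \<psi> B L
  proof (rule integrable_compact_support)
    show "compact (L - U)" using that U by (auto simp: cutoff_def intro: compact_diff)
    show "continuous_on (L - U) (\<lambda>x. B x * h x)"
      using that V by (intro continuous_intros)
        (auto simp: cutoff_def intro: continuous_on_subset
          continuous_on_subset[OF holomorphic_on_imp_continuous_on[OF V(3)]])
    show "B x * h x = 0" if "x \<notin> L - U" for x
      using that cutoff_gradient_support[OF \<open>cutoff \<psi> B L\<close>]
        cutoff_gradient_zero[OF \<open>cutoff \<psi> B L\<close> U(1)] \<open>\<And>x. x \<in> U \<Longrightarrow> \<psi> x = 1\<close>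
      by (metis DiffI mult_eq_0_iff)
  qed
  have "cutoff (\<lambda>x. \<phi> x - \<phi>' x) (\<lambda>x. A x - A' x) ((K \<union> K') - U)"
    using U by (intro cutoff_diff[OF \<phi> \<phi>']) auto
  then have "(\<integral>x. (A x - A' x) * h x \<partial>lborel) = 0"
    using V by (intro cutoff_integral_holomorphic)
  moreover have "(\<integral>x. (A x - A' x) * h x \<partial>lborel) = (\<integral>x. A x * h x \<partial>lborel) - (\<integral>x. A' x * h x \<partial>lborel)"
    using int[OF \<phi>] int[OF \<phi>'] U by (simp add: left_diff_distrib)
  ultimately show ?thesis by simp
qed

text \<open>Compare with the explicit radial cutoff \<open>\<phi>'\<close> whose gradient defines
  \<open>cutoff_mass\<close>. Both cutoffs are 1 on \<open>U \<inter> ball 0 1\<close>, which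
  contains the only pole of \<open>1 / x\<close>.\<close>

lemma cutoff_integral_inverse:
  assumes \<phi>: "cutoff \<phi> A K" and U: "open U" "0 \<in> U" "\<And>x. x \<in> U \<Longrightarrow> \<phi> x = 1"
  shows "(\<integral>x. A x * (1 / x) \<partial>lborel) = - of_real cutoff_mass"
proof -
  define u where "u x = 2 - x \<bullet> x" for x :: complex
  define s where "s x = (max 0 (u x))\<^sup>2" for x
  define \<phi>' where "\<phi>' x = 1 - (max 0 (1 - s x))\<^sup>2" for x
  define A' where "A' x = (2 * max 0 (1 - s x)) *\<^sub>R ((2 * max 0 (u x)) *\<^sub>R (- 2 *\<^sub>R x))" for x
  have u: "u x = 2 - (cmod x)\<^sup>2" for x by (simp add: u_def dot_square_norm)
  have contu: "continuous_on UNIV u" unfolding u_def by (intro continuous_intros)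
  have conts: "continuous_on UNIV s" unfolding s_def by (intro continuous_intros contu)
  have \<phi>': "cutoff \<phi>' A' (cball 0 2)"
    unfolding cutoff_def
  proof (intro conjI allI impI)
    show "continuous_on UNIV A'" unfolding A'_def by (intro continuous_intros conts contu)
    fix x
    have "(u has_derivative (\<lambda>v. (- 2 *\<^sub>R x) \<bullet> v)) (at x)"
      unfolding u_def by (auto intro!: derivative_eq_intros simp: inner_commute)
    then have ds: "(s has_derivative (\<lambda>v. ((2 * max 0 (u x)) *\<^sub>R (- 2 *\<^sub>R x)) \<bullet> v)) (at x)"
      unfolding s_def by (rule has_derivative_max_0_square)
    have "((\<lambda>x. 1 - s x) has_derivative (\<lambda>v. - (((2 * max 0 (u x)) *\<^sub>R (- 2 *\<^sub>R x)) \<bullet> v))) (at x)"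
      by (rule derivative_eq_intros ds refl)+ simp
    then show "(\<phi>' has_derivative (\<lambda>v. A' x \<bullet> v)) (at x)"
      unfolding \<phi>'_def A'_def by (rule has_derivative_one_minus_max_0_square)
  next
    fix x :: complex assume "x \<notin> cball 0 2"
    then have "2 ^ 2 \<le> (cmod x)\<^sup>2" by (intro power_mono) auto
    then show "\<phi>' x = 0" by (simp add: \<phi>'_def s_def u)
  qed simp
  have "\<phi>' x = 1" if "x \<in> ball 0 1" for x
  proof -
    have "(cmod x)\<^sup>2 < 1 ^ 2" using that by (intro power_strict_mono) auto
    then have "u x > 1" by (simp add: u)
    then have "s x \<ge> 1" by (simp add: s_def max_def power2_eq_square) (smt (verit) mult_le_cancel_left1)
    then show ?thesis by (simp add: \<phi>'_def)
  qed
  then have "(\<integral>x. A x * (1 / x) \<partial>lborel) = (\<integral>x. A' x * (1 / x) \<partial>lborel)"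
    using U by (intro cutoff_integral_independent[OF \<phi> \<phi>', of "U \<inter> ball 0 1" "- {0}"])
      (auto intro!: holomorphic_intros)
  \<comment> \<open>At \<open>x = 0\<close> the left side is 0 by the convention
    \<open>1 / 0 = 0\<close>; the right side is 0 too, since \<open>1 - 2\<^sup>2 < 0\<close> makes
    its first maximum vanish.\<close>
  also have "A' x * (1 / x) = - of_real (8 * max 0 (1 - (max 0 (2 - (cmod x)\<^sup>2))\<^sup>2) * max 0 (2 - (cmod x)\<^sup>2))" for x
    by (cases "x = 0") (simp_all add: A'_def s_def u scaleR_conv_of_real)
  then have "(\<integral>x. A' x * (1 / x) \<partial>lborel) = - of_real cutoff_mass"
    unfolding cutoff_mass_def by (simp only: Bochner_Integration.integral_minus integral_complex_of_real)
  finally show ?thesis .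
qed

text \<open>A Cauchy-Pompeiu formula. Split \<open>h x / x\<close> into
  \<open>(h x - h 0) / x\<close>, whose singularity at 0 is removable and which therefore
  contributes 0, and \<open>h 0 / x\<close>.\<close>

lemma cutoff_reproducing:
  assumes \<phi>: "cutoff \<phi> A K" and U: "open U" "0 \<in> U" "\<And>x. x \<in> U \<Longrightarrow> \<phi> x = 1"
    and V: "open V" "K \<subseteq> V" "h holomorphic_on V"
  shows "(\<integral>x. A x * (h x / x) \<partial>lborel) = - of_real cutoff_mass * h 0"
proof -
  have A0: "A x = 0" if "x \<notin> K - U" for x
    using that cutoff_gradient_support[OF \<phi>] cutoff_gradient_zero[OF \<phi> U(1)] U(3) by (metis DiffI)
  have KU: "compact (K - U)" using \<phi> U by (auto simp: cutoff_def intro: compact_diff)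
  have "0 \<in> K" using \<phi> U by (force simp: cutoff_def)
  then have "0 \<in> interior V" using V by (auto simp: interior_open)
  define k where "k x = (if x = 0 then deriv h 0 else (h x - h 0) / (x - 0))" for x
  have "k holomorphic_on V"
    unfolding k_def by (rule pole_lemma[OF V(3) \<open>0 \<in> interior V\<close>])
  then have "(\<integral>x. A x * k x \<partial>lborel) = 0"
    using V by (intro cutoff_integral_holomorphic[OF \<phi>])
  \<comment> \<open>At \<open>x = 0\<close> both sides are 0 because \<open>A\<close> vanishes on
    \<open>U\<close>, whatever value \<open>k\<close> has there.\<close>
  moreover have "A x * k x = A x * (h x / x) - A x * (1 / x) * h 0" for x
    using A0[of 0] U by (cases "x = 0") (auto simp: k_def diff_divide_distrib algebra_simps)
  moreover have "integrable lborel (\<lambda>x. A x * (l x / x))" if "continuous_on V l" for l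
  proof (rule integrable_compact_support[OF _ KU])
    show "continuous_on (K - U) (\<lambda>x. A x * (l x / x))"
      using \<phi> U V that by (intro continuous_intros) (auto simp: cutoff_def intro: continuous_on_subset)
  qed (use A0 in auto)
  from this[of h] this[of "\<lambda>_. 1"]
  have "integrable lborel (\<lambda>x. A x * (h x / x))" "integrable lborel (\<lambda>x. A x * (1 / x))"
    using V by (auto intro: holomorphic_on_imp_continuous_on)
  ultimately have "(\<integral>x. A x * (h x / x) \<partial>lborel) - (\<integral>x. A x * (1 / x) \<partial>lborel) * h 0 = 0"
    by (simp only: Bochner_Integration.integral_diff integrable_mult_left integral_mult_left_zero)
  then show ?thesis using cutoff_integral_inverse[OF \<phi> U] by simp
qed

subsection \<open>Holomorphic functions on complex vector spaces\<close>

lemma linear_vector_smult_left: "linear (\<lambda>c::complex. c *s w)"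
proof (rule linearI)
  show "(r *\<^sub>R b) *s w = r *\<^sub>R (b *s w)" for r and b :: complex
    by (simp add: vec_eq_iff)
qed (simp add: vec_eq_iff algebra_simps)

lemma norm_vector_smult: "norm ((c::complex) *s (w::complex ^ 'n)) = cmod c * norm w"
  by (simp add: norm_vec_def norm_mult L2_set_right_distrib)

lemma continuous_on_slice [continuous_intros]:
  "continuous_on S g \<Longrightarrow> continuous_on S (\<lambda>c. z + (g c :: complex) *s w)"
  using continuous_on_compose2[OF linear_continuous_on[OF linear_conv_bounded_linear[THEN iffD1, OF linear_vector_smult_left]], of S g UNIV w]
  by (intro continuous_on_add continuous_on_const) auto

lemma open_slice: "open U \<Longrightarrow> open {c::complex. z + c *s w \<in> U}"
  using open_vimage[of U "\<lambda>c. z + c *s w"] by (simp add: vimage_def continuous_intros)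

lemma closed_slice: "closed U \<Longrightarrow> closed {c::complex. z + c *s w \<in> U}"
  using closed_vimage[of U "\<lambda>c. z + c *s w"] by (simp add: vimage_def continuous_intros)

lemma holo_on_imp_continuous_on: "holo_on f U \<Longrightarrow> continuous_on U f"
  unfolding holo_on_def by (meson continuous_at_imp_continuous_on has_derivative_continuous)

lemma holo_on_subset: "holo_on f U \<Longrightarrow> V \<subseteq> U \<Longrightarrow> holo_on f V"
  by (auto simp: holo_on_def)

lemma holo_on_derivative:
  assumes "holo_on f U" "z \<in> U"
  shows "(f has_derivative frechet_derivative f (at z)) (at z)"
    "frechet_derivative f (at z) (c *s v) = c * frechet_derivative f (at z) v"
proof -
  obtain L where L: "(f has_derivative L) (at z)" "\<And>c v. L (c *s v) = c * L v"
    using assms unfolding holo_on_def by blast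
  then have "frechet_derivative f (at z) = L" using frechet_derivative_at by metis
  then show "(f has_derivative frechet_derivative f (at z)) (at z)"
    "frechet_derivative f (at z) (c *s v) = c * frechet_derivative f (at z) v" using L by auto
qed

lemma holo_on_slice_derivative:
  assumes "holo_on f U" "z + c *s w \<in> U"
  shows "((\<lambda>c. f (z + c *s w)) has_field_derivative frechet_derivative f (at (z + c *s w)) w) (at c)"
proof -
  have "((\<lambda>c. z + c *s w) has_derivative (\<lambda>d. d *s w)) (at c)"
    using linear_imp_has_derivative[OF linear_vector_smult_left] has_derivative_add[OF has_derivative_const]
    by fastforce
  from has_derivative_compose[OF this holo_on_derivative(1)[OF assms]]
  have "((\<lambda>c. f (z + c *s w)) has_derivative (\<lambda>d. d * frechet_derivative f (at (z + c *s w)) w)) (at c)"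
    unfolding holo_on_derivative(2)[OF assms] .
  then show ?thesis
    unfolding has_field_derivative_def
    by (rule has_derivative_eq_rhs) (simp add: fun_eq_iff)
qed

lemma holo_on_slice:
  assumes "holo_on f U"
  shows "(\<lambda>c. f (z + c *s w)) holomorphic_on {c. z + c *s w \<in> U}"
  unfolding holomorphic_on_def field_differentiable_def
  using holo_on_slice_derivative[OF assms] has_field_derivative_at_within by blast

text \<open>First-order Taylor expansion from 0 to 1, which lies in \<open>cball 0 (r / 2)\<close>
  as \<open>r \<ge> 2\<close>. Cauchy's inequality on circles of radius \<open>r / 3\<close> around
  points of that disc bounds the second derivative by \<open>2 * M / (r / 3)\<^sup>2\<close>; the
  circles stay inside \<open>ball 0 r\<close> since \<open>1/2 + 1/3 < 1\<close>.\<close>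

lemma holomorphic_quadratic_bound:
  assumes h: "h holomorphic_on ball 0 r" and B: "\<And>c. c \<in> ball 0 r \<Longrightarrow> cmod (h c) \<le> M"
    and r: "r \<ge> 2"
  shows "cmod (h 1 - h 0 - deriv h 0) \<le> 18 * M / r\<^sup>2"
proof -
  define S where "S = cball (0::complex) (r / 2)"
  have sub: "S \<subseteq> ball 0 r" using r by (auto simp: S_def)
  have der: "((deriv ^^ i) h has_field_derivative (deriv ^^ Suc i) h x) (at x within S)" if "x \<in> S" for i x
  proof -
    have "((deriv ^^ i) h has_field_derivative deriv ((deriv ^^ i) h) x) (at x)"
      using that sub by (intro holomorphic_derivI[OF holomorphic_higher_deriv[OF h open_ball] open_ball]) auto
    then show ?thesis by (simp add: has_field_derivative_at_within)
  qed
  have bd: "cmod ((deriv ^^ Suc 1) h x) \<le> 18 * M / r\<^sup>2" if x: "x \<in> S" for x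
  proof -
    have sub: "cball x (r / 3) \<subseteq> ball 0 r"
    proof
      fix y assume "y \<in> cball x (r / 3)"
      then have "cmod y \<le> r / 3 + r / 2"
        using x norm_triangle_sub[of y x] by (auto simp: S_def dist_norm norm_minus_commute)
      then show "y \<in> ball 0 r" using r by simp
    qed
    have "cmod ((deriv ^^ 2) h x) \<le> fact 2 * M / (r / 3)\<^sup>2"
    proof (rule Cauchy_inequality)
      show "h holomorphic_on ball x (r / 3)"
        using sub ball_subset_cball by (blast intro: holomorphic_on_subset[OF h])
      show "continuous_on (cball x (r / 3)) h"
        using sub by (blast intro: holomorphic_on_imp_continuous_on holomorphic_on_subset[OF h])
      show "cmod (h y) \<le> M" if "cmod (x - y) = r / 3" for y
        using sub that by (intro B) (auto simp: dist_norm)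
    qed (use r in auto)
    also have "\<dots> = 18 * M / r\<^sup>2" by (simp add: power2_eq_square)
    finally show ?thesis by (simp add: numeral_2_eq_2)
  qed
  have "cmod ((deriv ^^ 0) h 1 - (\<Sum>i\<le>1. (deriv ^^ i) h 0 * (1 - 0) ^ i / fact i))
      \<le> (18 * M / r\<^sup>2) * cmod (1 - 0) ^ Suc 1 / fact 1"
    using r by (intro complex_Taylor[of S] der bd) (auto simp: S_def)
  then show ?thesis by (simp add: diff_diff_eq)
qed

text \<open>The slice \<open>c \<mapsto> f (x + c *s h)\<close> is holomorphic on the disc of radius
  \<open>\<delta> / norm h \<ge> 2\<close>, so the one-variable bound applies. The constant depends
  only on \<open>M\<close> and \<open>\<delta>\<close>, giving a remainder uniform in the base
  point.\<close>

lemma holo_on_quadratic_bound: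
  assumes f: "holo_on f U" and U: "ball x \<delta> \<subseteq> U" and B: "\<And>y. y \<in> ball x \<delta> \<Longrightarrow> cmod (f y) \<le> M"
    and h: "norm h \<le> \<delta> / 2" and \<delta>: "\<delta> > 0"
  shows "cmod (f (x + h) - f x - frechet_derivative f (at x) h) \<le> 18 * M / \<delta>\<^sup>2 * (norm h)\<^sup>2"
proof (cases "h = 0")
  case True
  have "x \<in> U" using U \<delta> by auto
  then have "linear (frechet_derivative f (at x))"
    using f holo_on_derivative has_derivative_linear by blast
  then show ?thesis using True by (simp add: linear_0)
next
  case False
  define r where "r = \<delta> / norm h"
  define k where "k c = f (x + c *s h)" for c
  have ball: "x + c *s h \<in> ball x \<delta>" if "c \<in> ball 0 r" for c
    using that False by (simp add: r_def norm_vector_smult dist_norm field_simps)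
  have "k holomorphic_on ball 0 r"
    unfolding k_def using ball U by (intro holomorphic_on_subset[OF holo_on_slice[OF f]]) auto
  moreover have "r \<ge> 2" using h False by (simp add: r_def field_simps)
  moreover have "cmod (k c) \<le> M" if "c \<in> ball 0 r" for c unfolding k_def using ball[OF that] by (rule B)
  ultimately have "cmod (k 1 - k 0 - deriv k 0) \<le> 18 * M / r\<^sup>2"
    by (intro holomorphic_quadratic_bound)
  moreover have "deriv k 0 = frechet_derivative f (at x) h"
    unfolding k_def using subsetD[OF U, of x] \<delta> holo_on_slice_derivative[OF f, of x 0 h]
    by (intro DERIV_imp_deriv) auto
  ultimately show ?thesis by (simp add: k_def r_def field_simps)
qed

text \<open>Differentiation under the integral. A compact tube of radius \<open>\<delta>\<close>
  around the slice over \<open>S\<close> lies in \<open>U\<close> and \<open>f\<close> is bounded on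
  it, so the quadratic remainder is uniform in \<open>c \<in> S\<close>. Complex homogeneity passes
  through the integral.\<close>

lemma holo_on_integral:
  fixes f :: "complex ^ 'n \<Rightarrow> complex"
  assumes f: "holo_on f U" and U: "open U" and S: "compact S" and b: "continuous_on S b"
    and b0: "\<And>c. c \<notin> S \<Longrightarrow> b c = 0" and sub: "\<And>c. c \<in> S \<Longrightarrow> z + c *s w \<in> U"
  shows "\<exists>L. ((\<lambda>z. \<integral>c. b c * f (z + c *s w) \<partial>lborel) has_derivative L) (at z) \<and>
       (\<forall>c v. L (c *s v) = c * L v)"
proof -
  define T where "T = (\<lambda>c. z + c *s w) ` S"
  have "compact T" unfolding T_def using S by (intro compact_continuous_image continuous_intros)
  moreover have "T \<subseteq> U" using sub by (auto simp: T_def)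
  ultimately obtain \<delta> where \<delta>: "\<delta> > 0" "(\<Union>x\<in>T. cball x \<delta>) \<subseteq> U"
    using compact_subset_open_imp_cball_epsilon_subset[OF _ U, of T] by blast
  have N: "compact (\<Union>x\<in>T. cball x \<delta>)"
    using compact_minkowski_sum_cball[OF \<open>compact T\<close>] by simp
  then have "compact (f ` (\<Union>x\<in>T. cball x \<delta>))"
    using holo_on_imp_continuous_on[OF f] \<delta> by (blast intro: compact_continuous_image continuous_on_subset)
  then obtain M where M: "M > 0" "\<And>y. y \<in> (\<Union>x\<in>T. cball x \<delta>) \<Longrightarrow> cmod (f y) \<le> M"
    by (metis bounded_pos compact_imp_bounded imageI)
  define D where "D c h = frechet_derivative f (at (z + c *s w)) h" for c h
  define C where "C = 18 * M / \<delta>\<^sup>2"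
  have C: "C > 0" using M \<delta> by (simp add: C_def)
  have quad: "cmod (f (z + h + c *s w) - f (z + c *s w) - D c h) \<le> C * (norm h)\<^sup>2"
    if "c \<in> S" "norm h \<le> \<delta> / 2" for c h
  proof -
    have "z + c *s w \<in> T" using that by (auto simp: T_def)
    then have "ball (z + c *s w) \<delta> \<subseteq> (\<Union>x\<in>T. cball x \<delta>)" using ball_subset_cball by blast
    then have "cmod (f ((z + c *s w) + h) - f (z + c *s w) - D c h) \<le> C * (norm h)\<^sup>2"
      unfolding D_def C_def using \<delta> that M(2) by (intro holo_on_quadratic_bound[OF f]) blast+
    then show ?thesis by (simp add: algebra_simps)
  qed
  have contf: "continuous_on S (\<lambda>c. f (z + h + c *s w))" if "norm h \<le> \<delta>" for h
  proof (rule continuous_on_compose2[OF holo_on_imp_continuous_on[OF f]])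
    show "continuous_on S (\<lambda>c. z + h + c *s w)" by (intro continuous_intros)
    show "(\<lambda>c. z + h + c *s w) ` S \<subseteq> U"
    proof clarify
      fix c assume "c \<in> S"
      then have "z + c *s w \<in> T" by (auto simp: T_def)
      moreover have "z + h + c *s w \<in> cball (z + c *s w) \<delta>" using that by (simp add: dist_norm)
      ultimately show "z + h + c *s w \<in> U" using \<delta> by blast
    qed
  qed
  have linD: "linear (D c)" and clinD: "D c (a *s h) = a * D c h" if "c \<in> S" for c a h
    unfolding D_def using holo_on_derivative[OF f sub[OF that]] has_derivative_linear by auto
  \<comment> \<open>\<open>holo_on\<close> only provides pointwise derivatives. Their continuity
    along the slice, needed for integrability, follows because the difference quotients converge
    uniformly by \<open>quad\<close>.\<close>
  have contD: "continuous_on S (\<lambda>c. D c h)" for h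
  proof (rule uniform_limit_theorem)
    \<comment> \<open>Dividing by \<open>norm h + 1\<close> instead of \<open>norm h\<close> keeps
      \<open>t n\<close> well defined and positive for \<open>h = 0\<close> as well.\<close>
    define t where "t n = \<delta> / 2 / (norm h + 1) / real (Suc n)" for n
    have t: "t n > 0" "norm (t n *\<^sub>R h) \<le> \<delta> / 2" for n
    proof -
      show "t n > 0" unfolding t_def using \<delta> by (intro divide_pos_pos mult_pos_pos) (auto intro: add_nonneg_pos)
      then have "norm (t n *\<^sub>R h) \<le> t n * (norm h + 1)" by (simp add: algebra_simps)
      also have "\<dots> = \<delta> / 2 / real (Suc n)"
      proof -
        have "\<delta> / 2 / a / k * a = \<delta> / 2 / k" if "a \<noteq> 0" for a k :: real using that by simp
        moreover have "norm h + 1 \<noteq> 0" using norm_ge_zero[of h] by linarith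
        ultimately show ?thesis unfolding t_def by blast
      qed
      also have "\<dots> \<le> \<delta> / 2" using \<delta> by (simp add: field_simps)
      finally show "norm (t n *\<^sub>R h) \<le> \<delta> / 2" .
    qed
    show "\<forall>\<^sub>F n in sequentially. continuous_on S (\<lambda>c. (1 / t n) *\<^sub>R (f (z + t n *\<^sub>R h + c *s w) - f (z + c *s w)))"
    proof (intro always_eventually allI continuous_intros)
      fix n
      have "norm (t n *\<^sub>R h) \<le> \<delta>" using t(2)[of n] \<delta> by linarith
      then show "continuous_on S (\<lambda>c. f (z + t n *\<^sub>R h + c *s w))" by (rule contf)
      show "continuous_on S (\<lambda>c. f (z + c *s w))" using contf[of 0] \<delta> by simp
    qed
    show "uniform_limit S (\<lambda>n c. (1 / t n) *\<^sub>R (f (z + t n *\<^sub>R h + c *s w) - f (z + c *s w))) (\<lambda>c. D c h) sequentially"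
    proof (rule uniform_limitI)
      fix e :: real assume "e > 0"
      have "(\<lambda>n. C * t n * (norm h)\<^sup>2) \<longlonglongrightarrow> 0"
        unfolding t_def using norm_ge_zero[of h] by real_asymp
      then have "\<forall>\<^sub>F n in sequentially. C * t n * (norm h)\<^sup>2 < e"
        using \<open>e > 0\<close> by (rule order_tendstoD)
      then show "\<forall>\<^sub>F n in sequentially. \<forall>c\<in>S. dist ((1 / t n) *\<^sub>R (f (z + t n *\<^sub>R h + c *s w) - f (z + c *s w))) (D c h) < e"
      proof eventually_elim
        case (elim n)
        show ?case
        proof
          fix c assume c: "c \<in> S"
          have "(1 / t n) *\<^sub>R (f (z + t n *\<^sub>R h + c *s w) - f (z + c *s w)) - D c h
            = (1 / t n) *\<^sub>R (f (z + t n *\<^sub>R h + c *s w) - f (z + c *s w) - D c (t n *\<^sub>R h))"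
            using t(1)[of n] by (simp add: linear_cmul[OF linD[OF c]] scaleR_diff_right)
          then have "dist ((1 / t n) *\<^sub>R (f (z + t n *\<^sub>R h + c *s w) - f (z + c *s w))) (D c h)
            = (1 / t n) * cmod (f (z + t n *\<^sub>R h + c *s w) - f (z + c *s w) - D c (t n *\<^sub>R h))"
            using t(1)[of n] by (simp add: dist_norm)
          also have "\<dots> \<le> (1 / t n) * (C * (norm (t n *\<^sub>R h))\<^sup>2)"
            using t[of n] c by (intro mult_left_mono quad) auto
          also have "\<dots> = C * t n * (norm h)\<^sup>2"
            using t(1)[of n] by (simp add: power2_eq_square)
          finally show "dist ((1 / t n) *\<^sub>R (f (z + t n *\<^sub>R h + c *s w) - f (z + c *s w))) (D c h) < e"
            using elim by simp
        qed
      qed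
    qed
  qed auto
  define L where "L h = (\<integral>c. b c * D c h \<partial>lborel)" for h
  have intD: "integrable lborel (\<lambda>c. b c * D c h)" for h
    using b b0 contD by (intro integrable_compact_support[OF _ S] continuous_intros) auto
  have intf: "integrable lborel (\<lambda>c. b c * f (z + h + c *s w))" if "norm h \<le> \<delta>" for h
    using b b0 contf[OF that] by (intro integrable_compact_support[OF _ S] continuous_intros) auto
  have intb: "integrable lborel (\<lambda>c. cmod (b c))"
    using b b0 by (intro integrable_compact_support[OF _ S] continuous_intros) auto
  have bD: "b c * D c (h + k) = b c * D c h + b c * D c k" "b c * D c (r *\<^sub>R h) = r *\<^sub>R (b c * D c h)"
    "b c * D c (a *s h) = a * (b c * D c h)" for c h k r a
    using b0[of c] linear_add[OF linD, of c] linear_cmul[OF linD, of c] clinD[of c]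
    by (cases "c \<in> S"; simp add: algebra_simps)+
  have "linear L"
    by (rule linearI) (simp_all add: L_def bD intD)
  moreover have "L (a *s h) = a * L h" for a h
    by (simp add: L_def bD(3))
  moreover have "((\<lambda>z. \<integral>c. b c * f (z + c *s w) \<partial>lborel) has_derivative L) (at z)"
    unfolding has_derivative_at_alt
  proof (intro conjI allI impI)
    show "bounded_linear L" using \<open>linear L\<close> by (simp add: linear_conv_bounded_linear)
    fix e :: real assume e: "e > 0"
    define I where "I = (\<integral>c. cmod (b c) \<partial>lborel)"
    have I: "I \<ge> 0" unfolding I_def by (intro integral_nonneg_AE) auto
    \<comment> \<open>The first bound admits \<open>quad\<close>; the second makes
      \<open>C * I * norm h \<le> e\<close>, with \<open>I + 1\<close> in place of \<open>I\<close>
      in case the integral \<open>I\<close> is 0.\<close>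
    define d where "d = min (\<delta> / 2) (e / (C * (I + 1)))"
    have d: "d > 0" unfolding d_def using \<delta> e C I by simp
    have "norm ((\<integral>c. b c * f (y + c *s w) \<partial>lborel) - (\<integral>c. b c * f (z + c *s w) \<partial>lborel) - L (y - z)) \<le> e * norm (y - z)"
      if y: "norm (y - z) < d" for y
    proof -
      define h where "h = y - z"
      have h: "norm h \<le> \<delta> / 2" "norm h \<le> \<delta>" "norm h \<le> e / (C * (I + 1))"
        using y \<delta> by (auto simp: d_def h_def)
      have "(\<integral>c. b c * f (y + c *s w) \<partial>lborel) - (\<integral>c. b c * f (z + c *s w) \<partial>lborel) - L (y - z)
        = (\<integral>c. b c * (f (z + h + c *s w) - f (z + c *s w) - D c h) \<partial>lborel)"
        using intf[OF h(2)] intf[of 0] intD[of h] \<delta> by (simp add: L_def h_def right_diff_distrib)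
      also have "norm \<dots> \<le> (\<integral>c. cmod (b c) * (C * (norm h)\<^sup>2) \<partial>lborel)"
      proof (rule order_trans[OF integral_norm_bound integral_mono])
        show "integrable lborel (\<lambda>c. norm (b c * (f (z + h + c *s w) - f (z + c *s w) - D c h)))"
          using intf[OF h(2)] intf[of 0] intD[of h] \<delta> by (intro integrable_norm) (simp add: right_diff_distrib)
        show "integrable lborel (\<lambda>c. cmod (b c) * (C * (norm h)\<^sup>2))" using intb by simp
        show "norm (b c * (f (z + h + c *s w) - f (z + c *s w) - D c h)) \<le> cmod (b c) * (C * (norm h)\<^sup>2)" for c
          using quad[OF _ h(1), of c] b0[of c]
          by (cases "c \<in> S") (auto simp: norm_mult intro: mult_left_mono)
      qed
      also have "\<dots> = (C * I * norm h) * norm h"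
        by (simp add: I_def power2_eq_square mult_ac)
      also have "\<dots> \<le> e * norm h"
      proof (rule mult_right_mono)
        have "C * I * norm h \<le> C * (I + 1) * (e / (C * (I + 1)))"
          using C I h e by (intro mult_mono) auto
        then show "C * I * norm h \<le> e" using C I by simp
      qed simp
      finally show ?thesis by (simp add: h_def)
    qed
    then show "\<exists>d>0. \<forall>y. norm (y - z) < d \<longrightarrow>
       norm ((\<integral>c. b c * f (y + c *s w) \<partial>lborel) - (\<integral>c. b c * f (z + c *s w) \<partial>lborel) - L (y - z)) \<le> e * norm (y - z)"
      using d by blast
  qed
  ultimately show ?thesis by blast
qed

text \<open>The interior \<open>Z\<close> of the agreement set is open, and it is closed in
  \<open>U\<close>: near a limit point, agreement around one point \<open>q\<close> of a ball
  spreads along complex lines through \<open>q\<close> to the whole ball by the one-variable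
  identity theorem. Connectedness then gives \<open>Z = U\<close>.\<close>

lemma holo_on_identity:
  fixes f :: "complex ^ 'n \<Rightarrow> complex"
  assumes f: "holo_on f U" "holo_on g U" and U: "open U" "connected U"
    and W: "open W" "W \<subseteq> U" "W \<noteq> {}" "\<And>x. x \<in> W \<Longrightarrow> f x = g x" and z: "z \<in> U"
  shows "f z = g z"
proof -
  define Z where "Z = U \<inter> interior {x. f x = g x}"
  have "open Z" unfolding Z_def using U by (intro open_Int open_interior)
  moreover have "openin (top_of_set U) Z" using \<open>open Z\<close> U by (simp add: Z_def openin_open_eq)
  moreover have "closedin (top_of_set U) Z"
    unfolding closedin_limpt
  proof (intro conjI allI impI)
    show "Z \<subseteq> U" by (auto simp: Z_def)
    fix p assume p: "p islimpt Z \<and> p \<in> U"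
    obtain e where e: "e > 0" "ball p e \<subseteq> U" using U p open_contains_ball by blast
    obtain q where q: "q \<in> Z" "q \<in> ball p e"
      using p e by (meson centre_in_ball islimptE open_ball)
    have "f x = g x" if x: "x \<in> ball p e" for x
    proof -
      \<comment> \<open>The parameters of the line through \<open>q\<close> and \<open>x\<close>
        that stay in the ball: a convex set in which \<open>c = 0\<close> gives \<open>q\<close> and
        \<open>c = 1\<close> gives \<open>x\<close>.\<close>
      define S where "S = {c::complex. q + c *s (x - q) \<in> ball p e}"
      have "open S" unfolding S_def by (intro open_slice) simp
      have "convex S"
      proof -
        have "S = (\<lambda>c. c *s (x - q)) -` ball (p - q) e"
          by (simp add: S_def vimage_def dist_norm algebra_simps)
        then show ?thesis
          using convex_linear_vimage[OF linear_vector_smult_left convex_ball] by metis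
      qed
      define S0 where "S0 = {c::complex. q + c *s (x - q) \<in> ball p e \<inter> Z}"
      have "open S0" unfolding S0_def using \<open>open Z\<close> by (intro open_slice) auto
      have "f (q + 1 *s (x - q)) = g (q + 1 *s (x - q))"
      proof (rule analytic_continuation_open[of S0 S "\<lambda>c. f (q + c *s (x - q))" "\<lambda>c. g (q + c *s (x - q))"])
        show "S0 \<noteq> {}" using q by (auto simp: S0_def intro: exI[of _ 0])
        show "S0 \<subseteq> S" by (auto simp: S0_def S_def)
        show "connected S" using \<open>convex S\<close> by (rule convex_connected)
        show "(\<lambda>c. f (q + c *s (x - q))) holomorphic_on S" "(\<lambda>c. g (q + c *s (x - q))) holomorphic_on S"
          unfolding S_def using e
          by (intro holomorphic_on_subset[OF holo_on_slice[OF f(1)]]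
              holomorphic_on_subset[OF holo_on_slice[OF f(2)]]; blast)+
        show "f (q + c *s (x - q)) = g (q + c *s (x - q))" if "c \<in> S0" for c
          using that interior_subset[of "{x. f x = g x}"] by (auto simp: S0_def Z_def)
        show "1 \<in> S" using x by (simp add: S_def)
      qed (use \<open>open S\<close> \<open>open S0\<close> in auto)
      then show ?thesis by simp
    qed
    then have "ball p e \<subseteq> interior {x. f x = g x}" by (intro interior_maximal) auto
    then show "p \<in> Z" using p e by (auto simp: Z_def)
  qed
  moreover have "W \<subseteq> Z" using W by (auto simp: Z_def intro!: subsetD[OF interior_maximal[OF _ W(1)]])
  ultimately have "Z = U" using U W connected_clopen by blast
  then show ?thesis using z interior_subset[of "{x. f x = g x}"] by (auto simp: Z_def)
qed

subsection \<open>Complex lines transversal to a subspace\<close>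

lemma vector_smult_eq_Re_Im: "(c::complex) *s w = Re c *\<^sub>R w + Im c *\<^sub>R (\<i> *s w)"
  by (simp add: vec_eq_iff complex_eq_iff)

lemma linear_vector_smult_right: "linear (\<lambda>v::complex ^ 'n. c *s v)"
  by (rule linearI) (simp_all add: vec_eq_iff algebra_simps)

text \<open>If a nonzero multiple of \<open>y\<close> lies in \<open>H\<close>, then
  \<open>y\<close> is some \<open>h \<in> H\<close> rotated by a unit complex number. Such vectors
  form the image of a differentiable map with \<open>dim H + 1\<close> real parameters, a null set,
  so some \<open>y\<close> avoids them.\<close>

lemma exists_complex_line_transversal:
  fixes H :: "(complex ^ 'n) set"
  assumes H: "subspace H" "dim H + 3 \<le> DIM(complex ^ 'n)"
  obtains w where "norm w = 1" "\<And>c. c *s w \<in> H \<Longrightarrow> c = 0"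
proof -
  obtain u0 where u0: "u0 \<noteq> 0" "span H \<subseteq> {x. u0 \<bullet> x = 0}"
    using lowdim_subset_hyperplane[of H] H by auto
  define u where "u = (1 / norm u0) *\<^sub>R u0"
  have u: "u \<bullet> u = 1" "\<And>h. h \<in> H \<Longrightarrow> h \<bullet> u = 0"
    using u0 span_base[of _ H]
    by (auto simp: u_def dot_square_norm power2_eq_square inner_commute)
  \<comment> \<open>The rotation angle is stored as the coordinate along the unit normal
    \<open>u\<close> of \<open>H\<close>: \<open>F\<close> sends
    \<open>h + \<theta> *\<^sub>R u\<close> to \<open>cis \<theta> *s h\<close>. This turns the
    parameter space into a proper subspace of the same space.\<close>
  define F where "F x = cos (x \<bullet> u) *\<^sub>R (x - (x \<bullet> u) *\<^sub>R u) + sin (x \<bullet> u) *\<^sub>R (\<i> *s (x - (x \<bullet> u) *\<^sub>R u))" for x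
  have F: "F x = cis (x \<bullet> u) *s (x - (x \<bullet> u) *\<^sub>R u)" for x
    unfolding F_def by (subst vector_smult_eq_Re_Im[of "cis _"]) simp
  have J: "bounded_linear (\<lambda>v::complex ^ 'n. \<i> *s v)"
    using linear_vector_smult_right by (simp add: linear_conv_bounded_linear)
  have "F differentiable (at x within T)" for x T
    unfolding F_def differentiable_def
    by (rule exI) (rule derivative_eq_intros bounded_linear.has_derivative[OF J] refl)+
  then have "F differentiable_on span (insert u H)" by (simp add: differentiable_on_def)
  moreover have "dim (insert u H) < DIM(complex ^ 'n)" using H by (simp add: dim_insert)
  then have "negligible (span (insert u H))" by (intro negligible_lowdim) simp
  ultimately have "negligible (F ` span (insert u H))"
    by (intro negligible_differentiable_image_negligible) auto
  then obtain y where y: "y \<notin> F ` span (insert u H)"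
    using non_negligible_UNIV by (metis UNIV_eq_I)
  have 1: "c = 0" if "c *s y \<in> H" for c
  proof (rule ccontr)
    assume "c \<noteq> 0"
    \<comment> \<open>The modulus of \<open>1 / c\<close> is absorbed into \<open>H\<close>, which
      is closed under real scaling only; its argument becomes the angle.\<close>
    define h where "h = cmod (1 / c) *\<^sub>R (c *s y)"
    define x where "x = h + Arg (1 / c) *\<^sub>R u"
    have "h \<in> H" using that H by (simp add: h_def subspace_scale)
    then have "x \<in> span (insert u H)"
      unfolding x_def by (intro span_add span_scale span_base) auto
    moreover have "F x = cis (Arg (1 / c)) *s h"
      using u \<open>h \<in> H\<close> by (simp add: F x_def inner_add_left)
    moreover have "\<dots> = (of_real (cmod (1 / c)) * cis (Arg (1 / c)) * c) *s y"
      by (simp add: h_def vec_eq_iff scaleR_conv_of_real[where 'a=complex])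
    moreover have "of_real (cmod (1 / c)) * cis (Arg (1 / c)) = 1 / c"
      by (metis rcis_cmod_Arg rcis_def)
    ultimately have "F x = y" using \<open>c \<noteq> 0\<close> by simp
    then show False using y \<open>x \<in> _\<close> by blast
  qed
  have "y \<noteq> 0"
    using 1[of 1] subspace_0[OF H(1)] by auto
  show thesis
  proof (rule that)
    show "norm ((1 / norm y) *\<^sub>R y) = 1" using \<open>y \<noteq> 0\<close> by simp
    fix c assume "c *s ((1 / norm y) *\<^sub>R y) \<in> H"
    moreover have "c *s ((1 / norm y) *\<^sub>R y) = (c / of_real (norm y)) *s y"
      by (simp add: vec_eq_iff scaleR_conv_of_real[where 'a=complex])
    ultimately show "c = 0" using 1 \<open>y \<noteq> 0\<close> by fastforce
  qed
qed

text \<open>With \<open>L\<close> the direction space of \<open>H\<close>, the distance from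
  \<open>c *s w\<close> to \<open>L\<close> grows linearly in \<open>cmod c\<close>, because it has
  a positive minimum \<open>m\<close> on the unit circle. The vector \<open>v\<close> is a common
  normal of \<open>L\<close> and of the complex line spanned by \<open>w\<close>.\<close>

lemma affine_transversal_slices:
  fixes H :: "(complex ^ 'n) set"
  assumes H: "affine H" "H \<noteq> {}" "aff_dim H + 3 \<le> int DIM(complex ^ 'n)"
  obtains w v where "norm w = 1" "v \<noteq> 0" "\<And>c. v \<bullet> (c *s w) = 0"
    "\<And>x y. x \<in> H \<Longrightarrow> y \<in> H \<Longrightarrow> v \<bullet> x = v \<bullet> y"
    "\<And>M. \<exists>\<rho>. \<forall>z c. infdist z H \<le> M \<and> infdist (z + c *s w) H \<le> M \<longrightarrow> cmod c \<le> \<rho>"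
proof -
  obtain L where L: "subspace L" "affine_parallel H L"
    using affine_parallel_subspace[OF H(1,2)] by blast
  have dimL: "dim L + 3 \<le> DIM(complex ^ 'n)"
    using aff_dim_parallel_subspace[OF H(2) L(1)] L(2) H(1,3) by (simp add: affine_hull_eq[THEN iffD2])
  obtain a where a: "L = (\<lambda>x. a + x) ` H" using L(2) by (auto simp: affine_parallel_def)
  have diff: "x - y \<in> L" if "x \<in> H" "y \<in> H" for x y
    using that subspace_diff[OF L(1), of "a + x" "a + y"] by (simp add: a)
  obtain w where w: "norm w = 1" "\<And>c. c *s w \<in> L \<Longrightarrow> c = 0"
    using exists_complex_line_transversal[OF L(1) dimL] by blast
  \<comment> \<open>Codimension at least 3 enters here: adding the two real directions of the
    complex line still leaves room for a nonzero normal \<open>v\<close>.\<close>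
  have "dim (insert w (insert (\<i> *s w) L)) < DIM(complex ^ 'n)"
    using dimL by (simp add: dim_insert)
  then obtain v where v: "v \<noteq> 0" "span (insert w (insert (\<i> *s w) L)) \<subseteq> {x. v \<bullet> x = 0}"
    using lowdim_subset_hyperplane by blast
  have v0: "v \<bullet> x = 0" if "x \<in> insert w (insert (\<i> *s w) L)" for x
    using v span_base[OF that] by auto
  have vw: "v \<bullet> (c *s w) = 0" for c
    by (subst vector_smult_eq_Re_Im) (simp add: inner_add_right v0)
  have vH: "v \<bullet> x = v \<bullet> y" if "x \<in> H" "y \<in> H" for x y
    using v0[of "x - y"] diff[OF that] by (simp add: inner_diff_right)
  have "L \<noteq> {}" "closed L" using L subspace_0 closed_subspace by auto
  have "continuous_on (sphere 0 1) (\<lambda>c. infdist (0 + c *s w) L)"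
    by (intro continuous_intros)
  then obtain c0 where c0: "c0 \<in> sphere 0 1"
      "\<And>c. c \<in> sphere 0 1 \<Longrightarrow> infdist (c0 *s w) L \<le> infdist (c *s w) L"
    using continuous_attains_inf[of "sphere (0::complex) 1" "\<lambda>c. infdist (c *s w) L"] by auto
  define m where "m = infdist (c0 *s w) L"
  have "c0 *s w \<notin> L" using w(2)[of c0] c0(1) by auto
  then have m: "m > 0"
    using in_closed_iff_infdist_zero[OF \<open>closed L\<close> \<open>L \<noteq> {}\<close>] infdist_nonneg[of "c0 *s w" L]
    by (simp add: m_def less_le)
  have low: "m * cmod c \<le> norm (c *s w - h)" if "h \<in> L" for c h
  proof (cases "c = 0")
    case False
    have "m \<le> infdist ((c / of_real (cmod c)) *s w) L"
      unfolding m_def using False by (intro c0) (simp add: norm_divide)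
    also have "\<dots> \<le> dist ((c / of_real (cmod c)) *s w) ((1 / cmod c) *\<^sub>R h)"
      using that L(1) by (intro infdist_le) (simp add: subspace_scale)
    also have "(c / of_real (cmod c)) *s w = (1 / cmod c) *\<^sub>R (c *s w)"
      by (simp add: vec_eq_iff scaleR_conv_of_real[where 'a=complex])
    also have "dist ((1 / cmod c) *\<^sub>R (c *s w)) ((1 / cmod c) *\<^sub>R h) = norm (c *s w - h) / cmod c"
      by (simp add: dist_norm flip: scaleR_diff_right)
    finally show ?thesis using False by (simp add: field_simps)
  qed simp
  have "\<exists>\<rho>. \<forall>z c. infdist z H \<le> M \<and> infdist (z + c *s w) H \<le> M \<longrightarrow> cmod c \<le> \<rho>" for M
  proof (intro exI allI impI)
    fix z c assume zc: "infdist z H \<le> M \<and> infdist (z + c *s w) H \<le> M"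
    obtain q where q: "q \<in> H" "infdist z H = dist z q"
      using infdist_attains_inf[OF affine_closed[OF H(1)] H(2)] by blast
    obtain p where p: "p \<in> H" "infdist (z + c *s w) H = dist (z + c *s w) p"
      using infdist_attains_inf[OF affine_closed[OF H(1)] H(2)] by blast
    \<comment> \<open>With \<open>q\<close> and \<open>p\<close> nearest points of \<open>H\<close>,
      the difference \<open>p - q\<close> lies in \<open>L\<close>, so \<open>c *s w\<close> is
      within \<open>2 * M\<close> of \<open>L\<close>.\<close>
    have "m * cmod c \<le> norm (c *s w - (p - q))" by (rule low[OF diff[OF p(1) q(1)]])
    also have "\<dots> = norm ((z + c *s w - p) - (z - q))" by (simp add: algebra_simps)
    also have "\<dots> \<le> 2 * M"
      using norm_triangle_ineq4[of "z + c *s w - p" "z - q"] zc p q by (simp add: dist_norm)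
    finally show "cmod c \<le> 2 * M / m" using m by (simp add: field_simps)
  qed
  then show thesis using that w(1) v(1) vw vH by blast
qed

subsection \<open>Extension along slices\<close>

text \<open>\<open>bdd\<close> confines the slices of \<open>E\<close> over all points near
  \<open>z\<close> to one disc. This makes each slice compact and lets a cutoff chosen at
  \<open>z\<close> serve a whole neighbourhood of \<open>z\<close>.\<close>

lemma hartogs_extension_slices:
  fixes f :: "complex ^ 'n \<Rightarrow> complex"
  assumes \<Omega>: "open \<Omega>" and E: "closed E" "E \<subseteq> \<Omega>" and f: "holo_on f (\<Omega> - E)"
    and bdd: "\<And>z. \<exists>e>0. \<exists>\<rho>. \<forall>y c. dist y z < e \<and> y + c *s w \<in> E \<longrightarrow> cmod c \<le> \<rho>"
  obtains g where "holo_on g \<Omega>" "\<And>z. z \<in> \<Omega> \<Longrightarrow> (\<And>c. z + c *s w \<notin> E) \<Longrightarrow> g z = f z"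
proof -
  have \<Omega>E: "open (\<Omega> - E)" using \<Omega> E by (simp add: open_Diff)
  \<comment> \<open>An admissible cutoff lives in the slice of \<Omega> and is 1 near 0 and near the
    slice of \<open>E\<close>. Its gradient therefore sees only points where
    \<open>f (z + c *s w) / c\<close> is holomorphic.\<close>
  define adm where "adm z \<phi> A K U \<longleftrightarrow> cutoff \<phi> A K \<and> (\<forall>c\<in>K. z + c *s w \<in> \<Omega>) \<and> open U \<and> 0 \<in> U \<and>
    (\<forall>c. z + c *s w \<in> E \<longrightarrow> c \<in> U) \<and> (\<forall>c\<in>U. \<phi> c = 1)" for z \<phi> A K U
  define I where "I A z = (\<integral>c. A c * (f (z + c *s w) / c) \<partial>lborel)" for A z
  \<comment> \<open>Choosing the gradient by \<open>SOME\<close> is harmless: by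
    \<open>unique\<close> all admissible ones give the same integral.\<close>
  define g where "g z = - (I (SOME A. \<exists>\<phi> K U. adm z \<phi> A K U) z / of_real cutoff_mass)" for z
  have unique: "I A z = I A' z" if 1: "adm z \<phi> A K U" and 2: "adm z \<phi>' A' K' U'" for z \<phi> A K U \<phi>' A' K' U'
    unfolding I_def
  proof (rule cutoff_integral_independent[of \<phi> A K \<phi>' A' K', where U="U \<inter> U'" and V="{c. z + c *s w \<in> \<Omega> - E} - {0}"])
    show "open ({c. z + c *s w \<in> \<Omega> - E} - {0})" using open_slice[OF \<Omega>E] by blast
    show "(\<lambda>c. f (z + c *s w) / c) holomorphic_on {c. z + c *s w \<in> \<Omega> - E} - {0}"
      by (intro holomorphic_intros holomorphic_on_subset[OF holo_on_slice[OF f]]) auto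
  qed (use 1 2 in \<open>auto simp: adm_def\<close>)
  have g: "g z = - (I A z / of_real cutoff_mass)" if "adm z \<phi> A K U" for z \<phi> A K U
  proof -
    have "\<exists>\<phi> K U. adm z \<phi> (SOME A. \<exists>\<phi> K U. adm z \<phi> A K U) K U"
      using that by (intro someI_ex[of "\<lambda>A. \<exists>\<phi> K U. adm z \<phi> A K U"]) blast
    then show ?thesis using unique[OF that] by (auto simp: g_def)
  qed
  have ex: "\<exists>\<phi> A K U. adm z \<phi> A K U" if z: "z \<in> \<Omega>" for z
  proof -
    obtain e \<rho> where e: "e > 0" "\<And>y c. dist y z < e \<Longrightarrow> y + c *s w \<in> E \<Longrightarrow> cmod c \<le> \<rho>"
      using bdd[of z] by blast
    have "bounded {c. z + c *s w \<in> E}" unfolding bounded_iff using e(1) e(2)[of z] by auto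
    then have "compact {c. z + c *s w \<in> E}" using closed_slice[OF E(1)] compact_eq_bounded_closed by blast
    then have "compact (insert 0 {c. z + c *s w \<in> E})" by (rule compact_insert)
    moreover have "insert 0 {c. z + c *s w \<in> E} \<subseteq> {c. z + c *s w \<in> \<Omega>}" using z E by auto
    ultimately obtain \<phi> A K U where "cutoff \<phi> A K" "K \<subseteq> {c. z + c *s w \<in> \<Omega>}" "open U"
        "insert 0 {c. z + c *s w \<in> E} \<subseteq> U" "\<And>x. x \<in> U \<Longrightarrow> \<phi> x = 1"
      using cutoff_exists[OF _ open_slice[OF \<Omega>]] by metis
    then have "adm z \<phi> A K U" by (auto simp: adm_def)
    then show ?thesis by blast
  qed
  have near: "\<exists>d>0. \<forall>y\<in>ball z d. adm y \<phi> A K U" if adm: "adm z \<phi> A K U" for z \<phi> A K U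
  proof -
    obtain e \<rho> where e: "e > 0" "\<And>y c. dist y z < e \<Longrightarrow> y + c *s w \<in> E \<Longrightarrow> cmod c \<le> \<rho>"
      using bdd[of z] by blast
    have shift: "\<exists>d>0. \<forall>y\<in>ball z d. \<forall>c\<in>C. y + c *s w \<in> V"
      if C: "compact C" and V: "open V" "\<And>c. c \<in> C \<Longrightarrow> z + c *s w \<in> V" for C V
    proof -
      have "compact ((\<lambda>c. z + c *s w) ` C)" using C by (intro compact_continuous_image continuous_intros)
      then obtain d where d: "d > 0" "(\<Union>x\<in>(\<lambda>c. z + c *s w) ` C. cball x d) \<subseteq> V"
        using compact_subset_open_imp_cball_epsilon_subset[OF _ V(1)] V(2) by blast
      have "y + c *s w \<in> cball (z + c *s w) d" if "y \<in> ball z d" for y c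
        using that by (simp add: dist_norm)
      then show ?thesis using d by blast
    qed
    obtain d1 where d1: "d1 > 0" "\<And>y c. y \<in> ball z d1 \<Longrightarrow> c \<in> K \<Longrightarrow> y + c *s w \<in> \<Omega>"
      using shift[OF _ \<Omega>, of K] adm by (auto simp: adm_def cutoff_def)
    \<comment> \<open>For base points near \<open>z\<close>, parameters outside
      \<open>cball 0 \<rho>\<close> miss \<open>E\<close> by \<open>bdd\<close>, and those in the
      compact rest \<open>cball 0 \<rho> - U\<close> miss it by openness of \<open>- E\<close>. So
      the slices of \<open>E\<close> stay in \<open>U\<close>.\<close>
    have "compact (cball 0 \<rho> - U)" using adm by (intro compact_diff) (auto simp: adm_def)
    moreover have "open (- E)" using E by (simp add: open_Compl)
    ultimately obtain d2 where d2: "d2 > 0" "\<And>y c. y \<in> ball z d2 \<Longrightarrow> c \<in> cball 0 \<rho> - U \<Longrightarrow> y + c *s w \<in> - E"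
      using shift[of "cball 0 \<rho> - U" "- E"] adm unfolding adm_def by blast
    have "adm y \<phi> A K U" if y: "y \<in> ball z (min e (min d1 d2))" for y
      unfolding adm_def
    proof (intro conjI)
      show "\<forall>c. y + c *s w \<in> E \<longrightarrow> c \<in> U"
      proof (intro allI impI, rule ccontr)
        fix c assume "y + c *s w \<in> E" "c \<notin> U"
        moreover from this have "cmod c \<le> \<rho>" using e(2)[of y c] y by (simp add: dist_commute)
        ultimately show False using d2(2)[of y c] y by simp
      qed
    qed (use adm d1 y in \<open>auto simp: adm_def\<close>)
    then show ?thesis using e d1 d2 by (intro exI[of _ "min e (min d1 d2)"]) auto
  qed
  have "holo_on g \<Omega>"
    unfolding holo_on_def
  proof
    fix z assume "z \<in> \<Omega>"
    then obtain \<phi> A K U where adm: "adm z \<phi> A K U" using ex by blast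
    then obtain d where d: "d > 0" "\<And>y. y \<in> ball z d \<Longrightarrow> adm y \<phi> A K U" using near by blast
    have cut: "cutoff \<phi> A K" and U: "open U" "0 \<in> U" "\<And>x. x \<in> U \<Longrightarrow> \<phi> x = 1" using adm by (auto simp: adm_def)
    have "\<exists>L. ((\<lambda>z. \<integral>c. (A c / c) * f (z + c *s w) \<partial>lborel) has_derivative L) (at z) \<and>
       (\<forall>c v. L (c *s v) = c * L v)"
    proof (rule holo_on_integral[OF f \<Omega>E, of "K - U"])
      show "compact (K - U)" using cut U by (auto simp: cutoff_def intro: compact_diff)
      show "continuous_on (K - U) (\<lambda>c. A c / c)"
        using cut U by (intro continuous_intros) (auto simp: cutoff_def intro: continuous_on_subset)
      show "A c / c = 0" if "c \<notin> K - U" for c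
        using that cutoff_gradient_support[OF cut, of c] cutoff_gradient_zero[OF cut U(1) _ U(3), of c] by auto
      show "z + c *s w \<in> \<Omega> - E" if "c \<in> K - U" for c using that adm by (auto simp: adm_def)
    qed
    then obtain L where L: "((\<lambda>z. I A z) has_derivative L) (at z)" "\<And>c v. L (c *s v) = c * L v"
      unfolding I_def by auto
    have "((\<lambda>z. - (I A z / of_real cutoff_mass)) has_derivative (\<lambda>v. - (L v / of_real cutoff_mass))) (at z)"
      using cutoff_mass_nonzero by (auto intro!: derivative_eq_intros L(1))
    then have "(g has_derivative (\<lambda>v. - (L v / of_real cutoff_mass))) (at z)"
      by (rule has_derivative_transform_within_open[of _ _ _ _ "ball z d"])
        (use d g[OF d(2)] in auto)
    then show "\<exists>L. (g has_derivative L) (at z) \<and> (\<forall>c v. L (c *s v) = c * L v)"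
      using L(2) by (intro exI[of _ "\<lambda>v. - (L v / of_real cutoff_mass)"]) simp
  qed
  moreover have "g z = f z" if z: "z \<in> \<Omega>" "\<And>c. z + c *s w \<notin> E" for z
  proof -
    obtain \<phi> A K U where adm: "adm z \<phi> A K U" using ex z by blast
    have "I A z = - of_real cutoff_mass * f (z + 0 *s w)"
      unfolding I_def
    proof (rule cutoff_reproducing)
      show "cutoff \<phi> A K" "open U" "0 \<in> U" "\<And>x. x \<in> U \<Longrightarrow> \<phi> x = 1" using adm by (auto simp: adm_def)
      show "open {c. z + c *s w \<in> \<Omega> - E}" by (rule open_slice[OF \<Omega>E])
      show "K \<subseteq> {c. z + c *s w \<in> \<Omega> - E}" using adm z by (auto simp: adm_def)
      show "(\<lambda>c. f (z + c *s w)) holomorphic_on {c. z + c *s w \<in> \<Omega> - E}" by (rule holo_on_slice[OF f])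
    qed
    then show ?thesis using g[OF adm] cutoff_mass_nonzero by simp
  qed
  ultimately show thesis using that by blast
qed

subsection \<open>Square integrability\<close>

lemma nn_integral_translate:
  fixes F :: "'a::euclidean_space \<Rightarrow> ennreal"
  assumes "F \<in> borel_measurable borel"
  shows "(\<integral>\<^sup>+x. F (a + x) \<partial>lborel) = (\<integral>\<^sup>+x. F x \<partial>lborel)"
proof -
  have "(\<integral>\<^sup>+x. F x \<partial>lborel) = (\<integral>\<^sup>+x. F x \<partial>distr lborel borel ((+) a))"
    by (simp add: lborel_distr_plus)
  also have "\<dots> = (\<integral>\<^sup>+x. F (a + x) \<partial>lborel)"
    using assms by (intro nn_integral_distr) auto
  finally show ?thesis by simp
qed

text \<open>The reproducing formula is applied to the square of \<open>h\<close>, so that the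
  squared modulus appears under the integral directly; the kernel \<open>A c / c\<close> is bounded
  on \<open>K - U\<close> and zero elsewhere.\<close>

lemma holomorphic_L2_point_bound:
  fixes s :: real
  assumes "s > 0"
  obtains C where "C \<ge> 0" "\<And>h. h holomorphic_on ball 0 s \<Longrightarrow>
    ennreal ((cmod (h 0))\<^sup>2) \<le> ennreal C * (\<integral>\<^sup>+c. indicator (ball 0 s) c * ennreal ((cmod (h c))\<^sup>2) \<partial>lborel)"
proof -
  obtain \<phi> A K U where cut: "cutoff \<phi> A K" "K \<subseteq> ball 0 s" and U: "open U" "{0} \<subseteq> U" "\<And>x. x \<in> U \<Longrightarrow> \<phi> x = 1"
    using assms by (auto intro: cutoff_exists[of "{0}" "ball 0 s"])
  have A0: "A c = 0" if "c \<notin> K - U" for c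
    using that cutoff_gradient_support[OF cut(1), of c] cutoff_gradient_zero[OF cut(1) U(1) _ U(3), of c] by auto
  have KU: "compact (K - U)" using cut U by (auto simp: cutoff_def intro: compact_diff)
  have contA: "continuous_on (K - U) A" using cut by (auto simp: cutoff_def intro: continuous_on_subset)
  have "continuous_on (K - U) (\<lambda>c. A c / c)"
    using U by (intro continuous_intros contA) auto
  then have "compact ((\<lambda>c. A c / c) ` (K - U))"
    using KU by (rule compact_continuous_image)
  then have "bounded ((\<lambda>c. A c / c) ` (K - U))" by (rule compact_imp_bounded)
  then obtain B where B: "B > 0" "\<And>c. c \<in> K - U \<Longrightarrow> cmod (A c / c) \<le> B"
    unfolding bounded_pos by blast
  define m where "m = \<bar>cutoff_mass\<bar>"
  have m: "m > 0" using cutoff_mass_nonzero by (simp add: m_def)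
  show thesis
  proof (rule that[of "B / m"])
    show "B / m \<ge> 0" using B m by simp
    fix h assume h: "h holomorphic_on ball 0 s"
    have "(\<integral>c. A c * ((h c)\<^sup>2 / c) \<partial>lborel) = - of_real cutoff_mass * (h 0)\<^sup>2"
      using U cut h by (intro cutoff_reproducing[of \<phi> A K U "ball 0 s"]) (auto intro!: holomorphic_intros)
    then have eq: "cmod (\<integral>c. A c * ((h c)\<^sup>2 / c) \<partial>lborel) = m * (cmod (h 0))\<^sup>2"
      by (simp add: norm_mult norm_power m_def)
    have int: "integrable lborel (\<lambda>c. A c * ((h c)\<^sup>2 / c))"
    proof (rule integrable_compact_support[OF _ KU])
      have "continuous_on (K - U) h"
        using cut(2) by (intro continuous_on_subset[OF holomorphic_on_imp_continuous_on[OF h]]) auto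
      then show "continuous_on (K - U) (\<lambda>c. A c * ((h c)\<^sup>2 / c))"
        using U by (intro continuous_intros contA) auto
    qed (use A0 in auto)
    have "ennreal (m * (cmod (h 0))\<^sup>2) \<le> (\<integral>\<^sup>+c. ennreal (cmod (A c * ((h c)\<^sup>2 / c))) \<partial>lborel)"
      unfolding eq[symmetric] by (rule integral_norm_bound_ennreal[OF int])
    also have "\<dots> \<le> (\<integral>\<^sup>+c. ennreal B * (indicator (ball 0 s) c * ennreal ((cmod (h c))\<^sup>2)) \<partial>lborel)"
    proof (rule nn_integral_mono)
      fix c
      show "ennreal (cmod (A c * ((h c)\<^sup>2 / c))) \<le> ennreal B * (indicator (ball 0 s) c * ennreal ((cmod (h c))\<^sup>2))"
      proof (cases "c \<in> K - U")
        case True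
        have "cmod (A c * ((h c)\<^sup>2 / c)) = cmod (A c / c) * (cmod (h c))\<^sup>2"
          by (simp add: norm_mult norm_divide norm_power)
        also have "\<dots> \<le> B * (cmod (h c))\<^sup>2" using B True by (intro mult_right_mono) auto
        finally show ?thesis
          using True cut B by (auto simp: ennreal_mult[symmetric] intro!: ennreal_leI)
      qed (simp add: A0)
    qed
    also have "\<dots> = ennreal B * (\<integral>\<^sup>+c. indicator (ball 0 s) c * ennreal ((cmod (h c))\<^sup>2) \<partial>lborel)"
    proof (rule nn_integral_cmult)
      have "(\<lambda>c. indicator (ball 0 s) c *\<^sub>R (cmod (h c))\<^sup>2) \<in> borel_measurable borel"
        using h by (intro borel_measurable_continuous_on_indicator continuous_intros holomorphic_on_imp_continuous_on) auto
      then have "(\<lambda>c. ennreal (indicator (ball 0 s) c *\<^sub>R (cmod (h c))\<^sup>2)) \<in> borel_measurable lborel" by simp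
      then show "(\<lambda>c. indicator (ball 0 s) c * ennreal ((cmod (h c))\<^sup>2)) \<in> borel_measurable lborel"
        by (rule measurable_cong[THEN iffD1, rotated]) (simp add: indicator_def)
    qed
    finally have *: "ennreal (m * (cmod (h 0))\<^sup>2) \<le> ennreal B * (\<integral>\<^sup>+c. indicator (ball 0 s) c * ennreal ((cmod (h c))\<^sup>2) \<partial>lborel)" .
    have "ennreal ((cmod (h 0))\<^sup>2) = ennreal (1 / m) * ennreal (m * (cmod (h 0))\<^sup>2)"
      using m by (simp add: ennreal_mult[symmetric])
    also have "\<dots> \<le> ennreal (1 / m) * (ennreal B * (\<integral>\<^sup>+c. indicator (ball 0 s) c * ennreal ((cmod (h c))\<^sup>2) \<partial>lborel))"
      by (rule mult_left_mono[OF *]) simp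
    also have "\<dots> = ennreal (B / m) * (\<integral>\<^sup>+c. indicator (ball 0 s) c * ennreal ((cmod (h c))\<^sup>2) \<partial>lborel)"
      using B m by (simp add: mult.assoc[symmetric] ennreal_mult[symmetric])
    finally show "ennreal ((cmod (h 0))\<^sup>2) \<le> ennreal (B / m) * (\<integral>\<^sup>+c. indicator (ball 0 s) c * ennreal ((cmod (h c))\<^sup>2) \<partial>lborel)" .
  qed
qed

lemma infdist_plus_le: "infdist (x + y :: 'a::real_normed_vector) S \<le> infdist x S + norm y"
  using infdist_triangle[of "x + y" S x] by (simp add: dist_norm)

lemma infdist_le_plus: "infdist (x :: 'a::real_normed_vector) S \<le> infdist (x + y) S + norm y"
  using infdist_triangle[of x S "x + y"] by (simp add: dist_norm)

lemma borel_measurable_indicator_norm_square: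
  fixes g :: "'a::euclidean_space \<Rightarrow> complex"
  assumes "A \<in> sets borel" "continuous_on A g"
  shows "(\<lambda>x. indicator A x * (cmod (g x))\<^sup>2) \<in> borel_measurable borel"
    "(\<lambda>x. indicator A x * ennreal ((cmod (g x))\<^sup>2)) \<in> borel_measurable borel"
proof -
  show *: "(\<lambda>x. indicator A x * (cmod (g x))\<^sup>2) \<in> borel_measurable borel"
    using borel_measurable_continuous_on_indicator[of A "\<lambda>x. (cmod (g x))\<^sup>2"] assms
    by (simp add: continuous_intros)
  have "(\<lambda>x. indicator A x * ennreal ((cmod (g x))\<^sup>2)) = (\<lambda>x. ennreal (indicator A x * (cmod (g x))\<^sup>2))"
    by (auto simp: indicator_def)
  then show "(\<lambda>x. indicator A x * ennreal ((cmod (g x))\<^sup>2)) \<in> borel_measurable borel"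
    using * by simp
qed

text \<open>Maximum principle on the slice of the open \<open>s\<close>-tube around
  \<open>E\<close>: its frontier points are at distance exactly \<open>s\<close> from
  \<open>E\<close>, and around each of them a disc of radius \<open>s\<close> stays in \<Omega> but
  off \<open>E\<close>, where the area bound applies.\<close>

lemma L2_bound_across_slices:
  fixes g :: "complex ^ 'n \<Rightarrow> complex"
  assumes \<Omega>: "open \<Omega>" and E: "closed E" and s: "s > 0"
    and nbhd: "\<And>z. infdist z E \<le> 2 * s \<Longrightarrow> z \<in> \<Omega>" and g: "holo_on g \<Omega>" and w: "norm w = 1"
    and \<rho>: "\<And>z c. z \<in> E \<Longrightarrow> infdist (z + c *s w) E \<le> s \<Longrightarrow> cmod c \<le> \<rho>"
  obtains C where "C \<ge> 0" "\<And>z. z \<in> E \<Longrightarrow> ennreal ((cmod (g z))\<^sup>2) \<le>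
      ennreal C * (\<integral>\<^sup>+c. indicator (ball 0 (\<rho> + s)) c *
        (indicator (\<Omega> - E) (z + c *s w) * ennreal ((cmod (g (z + c *s w)))\<^sup>2)) \<partial>lborel)"
proof -
  obtain C where C: "C \<ge> 0" "\<And>h. h holomorphic_on ball 0 s \<Longrightarrow>
    ennreal ((cmod (h 0))\<^sup>2) \<le> ennreal C * (\<integral>\<^sup>+c. indicator (ball 0 s) c * ennreal ((cmod (h c))\<^sup>2) \<partial>lborel)"
    using holomorphic_L2_point_bound[OF s] by blast
  define \<Phi> where "\<Phi> x = indicator (\<Omega> - E) x * ennreal ((cmod (g x))\<^sup>2)" for x
  have \<Phi>: "\<Phi> \<in> borel_measurable borel"
    unfolding \<Phi>_def using \<Omega> E holo_on_imp_continuous_on[OF g]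
    by (intro borel_measurable_indicator_norm_square) (auto simp: open_Diff intro: continuous_on_subset)
  have slice: "(\<lambda>c. z + c *s w) \<in> borel_measurable borel" for z
    by (intro borel_measurable_continuous_onI continuous_intros)
  show thesis
  proof (rule that[OF C(1)])
    fix z assume z: "z \<in> E"
    define Q where "Q = (\<integral>\<^sup>+c. indicator (ball 0 (\<rho> + s)) c * \<Phi> (z + c *s w) \<partial>lborel)"
    have front: "ennreal ((cmod (g (z + a *s w)))\<^sup>2) \<le> ennreal C * Q"
      if a: "infdist (z + a *s w) E = s" for a
    proof -
      have a\<rho>: "cmod a \<le> \<rho>" using \<rho>[OF z] a by simp
      \<comment> \<open>A move shorter than \<open>s\<close> from distance \<open>s\<close> leaves
        the distance to \<open>E\<close> positive and at most \<open>2 * s\<close>.\<close>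
      have in\<Omega>: "z + a *s w + c *s w \<in> \<Omega> - E" if "c \<in> ball 0 s" for c
      proof -
        have c: "norm (c *s w) < s" using that w by (simp add: norm_vector_smult)
        have "infdist (z + a *s w + c *s w) E \<le> 2 * s"
          using infdist_plus_le[of "z + a *s w" "c *s w" E] a c by simp
        moreover have "infdist (z + a *s w + c *s w) E > 0"
          using infdist_le_plus[of "z + a *s w" E "c *s w"] a c by simp
        ultimately show ?thesis using nbhd by auto
      qed
      have "(\<lambda>c. g (z + a *s w + c *s w)) holomorphic_on ball 0 s"
        using in\<Omega> by (intro holomorphic_on_subset[OF holo_on_slice[OF g]]) auto
      from C(2)[OF this]
      have "ennreal ((cmod (g (z + a *s w)))\<^sup>2) \<le>
        ennreal C * (\<integral>\<^sup>+c. indicator (ball 0 s) c * ennreal ((cmod (g (z + a *s w + c *s w)))\<^sup>2) \<partial>lborel)" by simp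
      \<comment> \<open>Since \<open>cmod a \<le> \<rho>\<close>, the disc around \<open>a\<close>
        lies in \<open>ball 0 (\<rho> + s)\<close>. Enlarging to that ball and translating by
        \<open>a\<close> gives a bound independent of the frontier point.\<close>
      also have "\<dots> \<le> ennreal C * (\<integral>\<^sup>+c. indicator (ball 0 (\<rho> + s)) (a + c) * \<Phi> (z + (a + c) *s w) \<partial>lborel)"
      proof (intro mult_left_mono nn_integral_mono)
        fix c
        show "indicator (ball 0 s) c * ennreal ((cmod (g (z + a *s w + c *s w)))\<^sup>2)
          \<le> indicator (ball 0 (\<rho> + s)) (a + c) * \<Phi> (z + (a + c) *s w)"
        proof (cases "c \<in> ball 0 s")
          case True
          have "a + c \<in> ball 0 (\<rho> + s)" using True a\<rho> norm_triangle_ineq[of a c] by simp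
          moreover have "z + (a + c) *s w = z + a *s w + c *s w" by (simp add: vec_eq_iff algebra_simps)
          ultimately show ?thesis using in\<Omega>[OF True] True by (simp only: \<Phi>_def indicator_simps mult_1 order_refl)
        qed simp
      qed simp
      also have "(\<integral>\<^sup>+c. indicator (ball 0 (\<rho> + s)) (a + c) * \<Phi> (z + (a + c) *s w) \<partial>lborel) = Q"
        unfolding Q_def using measurable_compose[OF slice \<Phi>]
        by (intro nn_integral_translate borel_measurable_times_ennreal borel_measurable_indicator) auto
      finally show ?thesis .
    qed
    have "ennreal ((cmod (g z))\<^sup>2) \<le> ennreal C * Q"
    proof (cases "ennreal C * Q")
      case top
      then show ?thesis by simp
    next
      \<comment> \<open>The maximum principle needs a real bound \<open>q\<close>, which is why the
        infinite case is split off; it is applied to the square of \<open>g\<close> to match that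
        bound.\<close>
      case (real q)
      define S where "S = {c. infdist (z + c *s w) E < s}"
      have cont: "continuous_on UNIV (\<lambda>c. infdist (z + c *s w) E)" by (intro continuous_intros)
      have "open S" unfolding S_def using cont by (intro open_Collect_less continuous_intros)
      have cl: "closure S \<subseteq> {c. infdist (z + c *s w) E \<le> s}"
        unfolding S_def using cont by (intro closure_minimal closed_Collect_le continuous_intros) auto
      have sub: "{c. infdist (z + c *s w) E \<le> s} \<subseteq> {c. z + c *s w \<in> \<Omega>}"
        using nbhd s by auto
      have holo: "(\<lambda>c. (g (z + c *s w))\<^sup>2) holomorphic_on {c. z + c *s w \<in> \<Omega>}"
        by (intro holomorphic_intros holo_on_slice[OF g])
      have "cmod ((g (z + 0 *s w))\<^sup>2) \<le> q"
      proof (rule maximum_modulus_frontier[where S=S and f="\<lambda>c. (g (z + c *s w))\<^sup>2" and \<xi>=0])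
        show "(\<lambda>c. (g (z + c *s w))\<^sup>2) holomorphic_on interior S"
          using holomorphic_on_subset[OF holo] sub interior_subset[of S] closure_subset[of S] cl by blast
        show "continuous_on (closure S) (\<lambda>c. (g (z + c *s w))\<^sup>2)"
          using continuous_on_subset[OF holomorphic_on_imp_continuous_on[OF holo]] cl sub by blast
        show "bounded S" unfolding bounded_iff S_def using \<rho>[OF z] by (auto intro!: exI[of _ \<rho>])
        show "0 \<in> S" using z s by (simp add: S_def)
        fix a assume "a \<in> frontier S"
        then have "infdist (z + a *s w) E = s"
          using cl \<open>open S\<close> by (auto simp: frontier_def interior_open S_def)
        from front[OF this] real show "cmod ((g (z + a *s w))\<^sup>2) \<le> q"
          by (simp add: norm_power)
      qed
      then show ?thesis using real by (simp add: norm_power ennreal_leI)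
    qed
    then show "ennreal ((cmod (g z))\<^sup>2) \<le> ennreal C * (\<integral>\<^sup>+c. indicator (ball 0 (\<rho> + s)) c *
        (indicator (\<Omega> - E) (z + c *s w) * ennreal ((cmod (g (z + c *s w)))\<^sup>2)) \<partial>lborel)"
      by (simp add: Q_def \<Phi>_def)
  qed
qed

text \<open>Tonelli: after exchanging the integrals, translation invariance in \<open>z\<close>
  makes the inner one independent of \<open>c\<close>.\<close>

lemma nn_integral_slices:
  fixes \<Phi> :: "complex ^ 'n \<Rightarrow> ennreal"
  assumes \<Phi>: "\<Phi> \<in> borel_measurable borel" and B: "B \<in> sets borel"
  shows "(\<lambda>z. \<integral>\<^sup>+c. indicator B c * \<Phi> (z + c *s w) \<partial>lborel) \<in> borel_measurable borel"
    and "(\<integral>\<^sup>+z. (\<integral>\<^sup>+c. indicator B c * \<Phi> (z + c *s w) \<partial>lborel) \<partial>lborel)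
    = emeasure lborel B * (\<integral>\<^sup>+z. \<Phi> z \<partial>lborel)"
proof -
  have [measurable]: "(\<lambda>c. c *s w) \<in> borel_measurable borel"
    using continuous_on_slice[of UNIV "\<lambda>c. c" 0 w] by (intro borel_measurable_continuous_onI) simp
  note [measurable] = \<Phi> B
  show "(\<lambda>z. \<integral>\<^sup>+c. indicator B c * \<Phi> (z + c *s w) \<partial>lborel) \<in> borel_measurable borel"
    by measurable
  have "(\<integral>\<^sup>+z. (\<integral>\<^sup>+c. indicator B c * \<Phi> (z + c *s w) \<partial>lborel) \<partial>lborel)
    = (\<integral>\<^sup>+c. (\<integral>\<^sup>+z. indicator B c * \<Phi> (z + c *s w) \<partial>lborel) \<partial>lborel)"
    by (rule lborel_pair.Fubini'[symmetric]) measurable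
  also have "\<dots> = (\<integral>\<^sup>+c. indicator B c * (\<integral>\<^sup>+z. \<Phi> z \<partial>lborel) \<partial>lborel)"
  proof (rule nn_integral_cong)
    fix c
    have "(\<integral>\<^sup>+z. indicator B c * \<Phi> (z + c *s w) \<partial>lborel) = indicator B c * (\<integral>\<^sup>+z. \<Phi> (c *s w + z) \<partial>lborel)"
      by (subst nn_integral_cmult[symmetric]) (simp_all add: add.commute)
    then show "(\<integral>\<^sup>+z. indicator B c * \<Phi> (z + c *s w) \<partial>lborel) = indicator B c * (\<integral>\<^sup>+z. \<Phi> z \<partial>lborel)"
      by (simp add: nn_integral_translate[OF \<Phi>])
  qed
  also have "\<dots> = emeasure lborel B * (\<integral>\<^sup>+z. \<Phi> z \<partial>lborel)"
    using B by (subst nn_integral_multc) auto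
  finally show "(\<integral>\<^sup>+z. (\<integral>\<^sup>+c. indicator B c * \<Phi> (z + c *s w) \<partial>lborel) \<partial>lborel)
    = emeasure lborel B * (\<integral>\<^sup>+z. \<Phi> z \<partial>lborel)" .
qed

text \<open>The pointwise bound on \<open>E\<close>, integrated over all \<open>z\<close>, estimates
  the integral over \<open>E\<close> by a constant times the area of a disc times the finite
  integral over \<open>\<Omega> - E\<close>.\<close>

lemma square_integrable_across_slices:
  fixes g :: "complex ^ 'n \<Rightarrow> complex"
  assumes \<Omega>: "open \<Omega>" and E: "closed E" "E \<subseteq> \<Omega>" and s: "s > 0"
    and nbhd: "\<And>z. infdist z E \<le> 2 * s \<Longrightarrow> z \<in> \<Omega>" and g: "holo_on g \<Omega>" and w: "norm w = 1"
    and \<rho>: "\<And>z c. z \<in> E \<Longrightarrow> infdist (z + c *s w) E \<le> s \<Longrightarrow> cmod c \<le> \<rho>"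
    and int: "(\<lambda>z. (cmod (g z))\<^sup>2) integrable_on (\<Omega> - E)"
  shows "(\<lambda>z. (cmod (g z))\<^sup>2) integrable_on \<Omega>"
proof -
  define \<Phi> where "\<Phi> x = indicator (\<Omega> - E) x * ennreal ((cmod (g x))\<^sup>2)" for x
  have \<Omega>E: "open (\<Omega> - E)" using \<Omega> E by (simp add: open_Diff)
  have cont: "continuous_on \<Omega> g" using g by (rule holo_on_imp_continuous_on)
  have \<Phi>: "\<Phi> \<in> borel_measurable borel"
    unfolding \<Phi>_def using \<Omega>E cont
    by (intro borel_measurable_indicator_norm_square) (auto intro: continuous_on_subset)
  have gE: "(\<lambda>x. indicator E x * ennreal ((cmod (g x))\<^sup>2)) \<in> borel_measurable borel"
    using E cont by (intro borel_measurable_indicator_norm_square) (auto intro: continuous_on_subset)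
  obtain I where I: "((\<lambda>z. (cmod (g z))\<^sup>2) has_integral I) (\<Omega> - E)" using int by blast
  have "(\<integral>\<^sup>+x. ennreal (indicator (\<Omega> - E) x * (cmod (g x))\<^sup>2) \<partial>lborel) = ennreal I"
    by (rule nn_integral_has_integral_lebesgue[OF _ I]) simp
  moreover have "ennreal (indicator (\<Omega> - E) x * (cmod (g x))\<^sup>2) = \<Phi> x" for x
    by (auto simp: \<Phi>_def indicator_def)
  ultimately have \<Phi>fin: "(\<integral>\<^sup>+x. \<Phi> x \<partial>lborel) < \<infinity>" by simp
  obtain C where C: "C \<ge> 0" "\<And>z. z \<in> E \<Longrightarrow> ennreal ((cmod (g z))\<^sup>2) \<le>
      ennreal C * (\<integral>\<^sup>+c. indicator (ball 0 (\<rho> + s)) c * \<Phi> (z + c *s w) \<partial>lborel)"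
  proof (rule L2_bound_across_slices[OF \<Omega> E(1) s nbhd g w \<rho>])
  qed (simp_all add: \<Phi>_def that)
  have "(\<integral>\<^sup>+z. indicator E z * ennreal ((cmod (g z))\<^sup>2) \<partial>lborel)
    \<le> (\<integral>\<^sup>+z. ennreal C * (\<integral>\<^sup>+c. indicator (ball 0 (\<rho> + s)) c * \<Phi> (z + c *s w) \<partial>lborel) \<partial>lborel)"
    using C(2) by (intro nn_integral_mono) (auto simp: indicator_def)
  also have "\<dots> = ennreal C * (emeasure lborel (ball 0 (\<rho> + s) :: complex set) * (\<integral>\<^sup>+z. \<Phi> z \<partial>lborel))"
    by (simp add: nn_integral_cmult nn_integral_slices[OF \<Phi>])
  also have "\<dots> < \<infinity>"
    using \<Phi>fin emeasure_lborel_ball_finite[of "0::complex" "\<rho> + s"]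
    by (auto simp: ennreal_mult_less_top)
  finally have Efin: "(\<integral>\<^sup>+z. indicator E z * ennreal ((cmod (g z))\<^sup>2) \<partial>lborel) < \<infinity>" .
  have "(\<integral>\<^sup>+x. ennreal (indicator \<Omega> x * (cmod (g x))\<^sup>2) \<partial>lborel)
    = (\<integral>\<^sup>+x. \<Phi> x + indicator E x * ennreal ((cmod (g x))\<^sup>2) \<partial>lborel)"
    using E(2) by (intro nn_integral_cong) (auto simp: \<Phi>_def indicator_def)
  also have "\<dots> < \<infinity>"
    using \<Phi>fin Efin \<Phi> gE by (subst nn_integral_add) auto
  finally have "(\<lambda>x. indicator \<Omega> x * (cmod (g x))\<^sup>2) integrable_on UNIV"
    using \<Omega> cont by (intro nn_integral_integrable_on borel_measurable_indicator_norm_square) auto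
  moreover have "(\<lambda>x. indicator \<Omega> x * (cmod (g x))\<^sup>2) = (\<lambda>x. if x \<in> \<Omega> then (cmod (g x))\<^sup>2 else 0)"
    by (auto simp: indicator_def)
  ultimately show ?thesis by (simp add: integrable_restrict_UNIV)
qed

section \<open>Extension across \<open>E\<close> and equality of the Bergman spaces\<close>

theorem theorem1p1:
  fixes \<Omega> E :: "(complex ^ 'n) set"
  assumes n2: "CARD('n) \<ge> 2"
    and dom: "open \<Omega>" "connected \<Omega>" "\<Omega> \<noteq> {}"
    and clE: "closed E"
    and c1: "\<exists>r>0. closed_nbhd E r \<subseteq> \<Omega>"
    and c2: "\<exists>H R. affine H \<and> H \<noteq> {} \<and> aff_dim H + 3 \<le> int DIM(complex ^ 'n) \<and> R > 0
                 \<and> E \<subseteq> open_nbhd H R"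
    and c3: "connected (\<Omega> - E)"
  shows "\<forall>f. bergman (\<Omega> - E) f \<longrightarrow> (\<exists>g. bergman \<Omega> g \<and> (\<forall>z\<in>\<Omega> - E. g z = f z))"
proof (intro allI impI)
  fix f assume f: "bergman (\<Omega> - E) f"
  show "\<exists>g. bergman \<Omega> g \<and> (\<forall>z\<in>\<Omega> - E. g z = f z)"
  proof (cases "E = {}")
    \<comment> \<open>Handled apart because \<open>infdist\<close> to the empty set is 0 by default,
      so the distance arguments below need a point of \<open>E\<close>; here \<open>f\<close> itself
      is the extension.\<close>
    case True
    then show ?thesis using f by auto
  next
    case False
    obtain r where r: "r > 0" "\<And>z. infdist z E \<le> r \<Longrightarrow> z \<in> \<Omega>"
      using c1 False by (auto simp: closed_nbhd_def)
    have E\<Omega>: "E \<subseteq> \<Omega>" using r by auto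
    obtain H R where H: "affine H" "H \<noteq> {}" "aff_dim H + 3 \<le> int DIM(complex ^ 'n)"
      and R: "R > 0" "\<And>z. z \<in> E \<Longrightarrow> infdist z H < R"
      using c2 by (auto simp: open_nbhd_def)
    obtain w v where w: "norm w = 1" and v: "v \<noteq> 0" "\<And>c. v \<bullet> (c *s w) = 0"
        "\<And>x y. x \<in> H \<Longrightarrow> y \<in> H \<Longrightarrow> v \<bullet> x = v \<bullet> y"
      and bdd: "\<And>M. \<exists>\<rho>. \<forall>z c. infdist z H \<le> M \<and> infdist (z + c *s w) H \<le> M \<longrightarrow> cmod c \<le> \<rho>"
      using affine_transversal_slices[OF H] by metis
    have holof: "holo_on f (\<Omega> - E)" using f by (simp add: bergman_def)
    have "\<exists>e>0. \<exists>\<rho>. \<forall>y c. dist y z < e \<and> y + c *s w \<in> E \<longrightarrow> cmod c \<le> \<rho>" for z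
    proof -
      \<comment> \<open>The maximum covers both ends of the slice: \<open>y\<close> is within
        \<open>infdist z H + 1\<close> of \<open>H\<close>, and the point of \<open>E\<close> within
        \<open>R\<close>.\<close>
      obtain \<rho> where \<rho>: "\<And>y c. infdist y H \<le> max R (infdist z H + 1) \<Longrightarrow>
          infdist (y + c *s w) H \<le> max R (infdist z H + 1) \<Longrightarrow> cmod c \<le> \<rho>"
        using bdd by metis
      have "cmod c \<le> \<rho>" if "dist y z < 1" "y + c *s w \<in> E" for y c
        using that R(2)[OF that(2)] infdist_triangle[of y H z] by (intro \<rho>[of y]) auto
      then show ?thesis by (intro exI[of _ 1]) auto
    qed
    then obtain g where g: "holo_on g \<Omega>" "\<And>z. z \<in> \<Omega> \<Longrightarrow> (\<And>c. z + c *s w \<notin> E) \<Longrightarrow> g z = f z"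
      using hartogs_extension_slices[OF dom(1) clE E\<Omega> holof] by metis
    obtain h0 where h0: "h0 \<in> H" using H by blast
    \<comment> \<open>The functional of \<open>v\<close> is constant on \<open>H\<close>, hence
      bounded above on the \<open>R\<close>-tube around it, although \<open>E\<close> itself may be
      unbounded.\<close>
    have vE: "v \<bullet> z \<le> v \<bullet> h0 + norm v * R" if z: "z \<in> E" for z
    proof -
      obtain q where q: "q \<in> H" "infdist z H = dist z q"
        using infdist_attains_inf[OF affine_closed[OF H(1)] H(2)] by blast
      have "v \<bullet> (z - q) \<le> norm v * norm (z - q)" by (rule norm_cauchy_schwarz)
      also have "\<dots> \<le> norm v * R" using R(2)[OF z] q by (intro mult_left_mono) (auto simp: dist_norm)
      finally show ?thesis using v(3)[OF q(1) h0] by (simp add: inner_diff_right)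
    qed
    define M where "M = Sup ((\<lambda>z. v \<bullet> z) ` E)"
    have bddE: "bdd_above ((\<lambda>z. v \<bullet> z) ` E)" using vE by (rule bdd_aboveI2)
    have M: "v \<bullet> z \<le> M" if "z \<in> E" for z
      unfolding M_def using that bddE by (intro cSUP_upper)
    \<comment> \<open>Lines in direction \<open>w\<close> keep the value of \<open>v\<close>, so
      those starting beyond the supremum \<open>M\<close> never meet \<open>E\<close>.\<close>
    define W where "W = \<Omega> \<inter> {z. M < v \<bullet> z}"
    have "open W" unfolding W_def by (intro open_Int dom open_Collect_less continuous_intros)
    moreover have "W \<noteq> {}"
    proof -
      have "M - norm v * r < M" using v r by simp
      then obtain z where z: "z \<in> E" "M - norm v * r < v \<bullet> z"
        unfolding M_def using less_cSUP_iff[OF False bddE] by blast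
      \<comment> \<open>Moving a distance \<open>r\<close> along \<open>v\<close> raises the value
        by \<open>norm v * r\<close>, enough to pass \<open>M\<close> from the nearly maximal
        \<open>z\<close>, and stays in the closed \<open>r\<close>-neighbourhood inside
        \<Omega>.\<close>
      define y where "y = z + (r / norm v) *\<^sub>R v"
      have "infdist y E \<le> r"
        using infdist_le[OF z(1), of y] v r by (simp add: y_def dist_norm)
      moreover have "v \<bullet> y = v \<bullet> z + norm v * r"
        using v by (simp add: y_def inner_add_right dot_square_norm power2_eq_square)
      ultimately have "y \<in> W" using r(2)[of y] z(2) by (simp add: W_def)
      then show ?thesis by blast
    qed
    moreover have "W \<subseteq> \<Omega> - E" using M by (fastforce simp: W_def)
    moreover have "g x = f x" if "x \<in> W" for x
    proof (rule g(2))
      show "x + c *s w \<notin> E" for c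
        using that M[of "x + c *s w"] v(2)[of c] by (auto simp: W_def inner_add_right)
    qed (use that in \<open>simp add: W_def\<close>)
    ultimately have gf: "g z = f z" if "z \<in> \<Omega> - E" for z
      using that c3 dom(1) clE holof holo_on_subset[OF g(1), of "\<Omega> - E"]
      by (intro holo_on_identity[of g "\<Omega> - E" f W z]) (auto simp: open_Diff)
    obtain \<rho> where \<rho>: "\<And>z c. infdist z H \<le> R + r \<Longrightarrow> infdist (z + c *s w) H \<le> R + r \<Longrightarrow> cmod c \<le> \<rho>"
      using bdd by metis
    have "(\<lambda>z. (cmod (g z))\<^sup>2) integrable_on \<Omega>"
    \<comment> \<open>The tube radius is \<open>r / 2\<close> because its double must still fit into
      \<Omega>; points of that tube are within \<open>R + r\<close> of \<open>H\<close>, so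
      \<open>\<rho>\<close> applies.\<close>
    proof (rule square_integrable_across_slices[OF dom(1) clE E\<Omega> _ _ g(1) w, of "r / 2" \<rho>])
      show "(\<lambda>z. (cmod (g z))\<^sup>2) integrable_on \<Omega> - E"
        using f gf integrable_cong[of "\<Omega> - E" "\<lambda>z. (cmod (g z))\<^sup>2" "\<lambda>z. (cmod (f z))\<^sup>2"]
        by (simp add: bergman_def)
      fix z c assume z: "z \<in> E" and zc: "infdist (z + c *s w) E \<le> r / 2"
      obtain e where e: "e \<in> E" "infdist (z + c *s w) E = dist (z + c *s w) e"
        using infdist_attains_inf[OF clE False] by blast
      have "infdist (z + c *s w) H \<le> R + r"
        using infdist_triangle[of "z + c *s w" H e] R(2)[OF e(1)] e(2) zc r by simp
      then show "cmod c \<le> \<rho>" using R(2)[OF z] r by (intro \<rho>[of z c]) auto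
    qed (use r in auto)
    then have "bergman \<Omega> g" using g(1) by (simp add: bergman_def)
    then show ?thesis using gf by blast
  qed
qed

end
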